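(* Let $\mathbb{U}$ be a monster model of $\operatorname{Th}(\mathcal{U})$. If $A,B,C\subset\mathbb{U}$ are small, then $A\mathop{\smile\!\!\!\!\!\mid}^d_C B$ if and only if for all $b_1,b_2\in B$, $$d_{\max}(b_1,b_2/AC)=d_{\max}(b_1,b_2/C)\quad\text{and}\quad d_{\min}(b_1,b_2/AC)=d_{\min}(b_1,b_2/C).$$
   Context: $\mathcal{U}$ is the Urysohn sphere (the unique complete separable metric space of diameter 1 that is ultrahomogeneous and universal for separable metric spaces of diameter $\le 1$), viewed as a continuous-logic structure in the language with only the metric $d$; $\mathbb{U}$ is a sufficiently saturated monster model, and small means $\mathbb{U}$ is $\chi(A)^+$-saturated. Distance arithmetic is truncated at $1$; $\sup\emptyset=0$, $\inf\emptyset=1$. $d_{\max}(b_1,b_2/C)=\inf_{c\in C}(d(b_1,c)+d(b_2,c))$, $d_{\min}(b_1,b_2/C)=\max\{\sup_{c\in C}|d(b_1,c)-d(b_2,c)|,\tfrac13 d(b_1,b_2)\}$. A formula $\varphi(\bar x,\bar b)$ divides over $C$ if there are $(\bar b^l)_{l<\omega}$ with $\operatorname{tp}(\bar b^l/C)=\operatorname{tp}(\bar b/C)$, $\epsilon>0$ and $k>0$ such that every $k$-element subset of $\{\varphi(\bar x,\bar b^l)\le\epsilon:l<\omega\}$ is unsatisfiable (where "$\varphi\le\epsilon$" is the condition $\max(\varphi-\epsilon,0)=0$). A partial type divides over $C$ if some formula $\varphi(\bar x,\bar b)$ dividing over $C$ takes value $0$ at every realization of the type. $A\mathop{\smile\!\!\!\!\!\mid}^d_C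 B$ means $\operatorname{tp}(A/BC)$ does not divide over $C$. *)

theory Defs
  imports "HOL-Analysis.Analysis" "HOL-Library.More_List"
begin

unbundle cardinal_syntax

section \<open>Continuous logic in the language with only the metric\<close>

text \<open>
  A connective of arity \<open>n\<close> is a continuous function from \<open>[0,1]\<^sup>n\<close> to \<open>[0,1]\<close>.
  As \<open>n\<close> is the length of the argument list, the cube \<open>[0,1]\<^sup>n\<close> is represented by
  the sequences in \<open>[0,1]\<close> that vanish from index \<open>n\<close> on, and its topology is the one
  inherited from the product topology.
\<close>

datatype fm =
    Dist nat nat
  | Conn "(nat \<Rightarrow> real) \<Rightarrow> real" "fm list"
  | SupQ nat fm
  | InfQ nat fm

definition cube :: "nat \<Rightarrow> (nat \<Rightarrow> real) set" where
  "cube n = {v. (\<forall>i. 0 \<le> v i \<and> v i \<le> 1) \<and> (\<forall>i\<ge>n. v i = 0)}"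

definition connective :: "nat \<Rightarrow> ((nat \<Rightarrow> real) \<Rightarrow> real) \<Rightarrow> bool" where
  "connective n u \<longleftrightarrow> continuous_on (cube n) u \<and> u ` cube n \<subseteq> {0..1}"

fun wf_fm :: "fm \<Rightarrow> bool" where
  "wf_fm (Dist i j) \<longleftrightarrow> True"
| "wf_fm (Conn u \<phi>s) \<longleftrightarrow> connective (length \<phi>s) u \<and> (\<forall>\<phi>\<in>set \<phi>s. wf_fm \<phi>)"
| "wf_fm (SupQ i \<phi>) \<longleftrightarrow> wf_fm \<phi>"
| "wf_fm (InfQ i \<phi>) \<longleftrightarrow> wf_fm \<phi>"

fun free_vars :: "fm \<Rightarrow> nat set" where
  "free_vars (Dist i j) = {i, j}"
| "free_vars (Conn u \<phi>s) = (\<Union>\<phi>\<in>set \<phi>s. free_vars \<phi>)"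
| "free_vars (SupQ i \<phi>) = free_vars \<phi> - {i}"
| "free_vars (InfQ i \<phi>) = free_vars \<phi> - {i}"

fun val :: "'a metric \<Rightarrow> (nat \<Rightarrow> 'a) \<Rightarrow> fm \<Rightarrow> real" where
  "val M s (Dist i j) = mdist M (s i) (s j)"
| "val M s (Conn u \<phi>s) = u (nth_default 0 (map (\<lambda>\<phi>. val M s \<phi>) \<phi>s))"
| "val M s (SupQ i \<phi>) = (SUP x\<in>mspace M. val M (s(i := x)) \<phi>)"
| "val M s (InfQ i \<phi>) = (INF x\<in>mspace M. val M (s(i := x)) \<phi>)"

text \<open>
  \<open>fm_of_arity n \<phi>\<close>: the free variables of \<open>\<phi>\<close> are among \<open>x\<^sub>0, \<dots>, x\<^bsub>n-1\<^esub>\<close>, so that \<open>\<phi>\<close> can be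
  evaluated at a tuple (list) of length \<open>n\<close>. In \<open>\<phi>(x, y)\<close> the variables of the tuple \<open>x\<close>
  come first and those of \<open>y\<close> follow.
\<close>

definition fm_of_arity :: "nat \<Rightarrow> fm \<Rightarrow> bool" where
  "fm_of_arity n \<phi> \<longleftrightarrow> wf_fm \<phi> \<and> free_vars \<phi> \<subseteq> {..<n}"

definition val_at :: "'a metric \<Rightarrow> fm \<Rightarrow> 'a list \<Rightarrow> real" where
  "val_at M \<phi> as = val M (nth as) \<phi>"

definition metric_structure :: "'a metric \<Rightarrow> bool" where
  "metric_structure M \<longleftrightarrow> mspace M \<noteq> {} \<and> mcomplete_of M \<and>
     (\<forall>x\<in>mspace M. \<forall>y\<in>mspace M. mdist M x y \<le> 1)"

text \<open>A theory is a set of closed conditions \<open>\<phi> = 0\<close>, each given by the sentence \<open>\<phi>\<close>.\<close>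

definition Th :: "'a metric \<Rightarrow> fm set" where
  "Th M = {\<phi>. fm_of_arity 0 \<phi> \<and> val_at M \<phi> [] = 0}"

definition model_of :: "'a metric \<Rightarrow> fm set \<Rightarrow> bool" where
  "model_of M T \<longleftrightarrow> metric_structure M \<and> (\<forall>\<phi>\<in>T. val_at M \<phi> [] = 0)"

section \<open>Types and saturation\<close>

text \<open>
  \<open>(\<phi>, is, es)\<close> stands for the condition \<open>\<phi>(x, e) = 0\<close>, where \<open>x\<close> is the tuple of the
  variables indexed by the entries of \<open>is\<close> and \<open>e = es\<close> is a tuple of parameters. Arbitrary
  index sets \<open>I\<close> are allowed since the type of an infinite set has one variable for each
  of its elements.
\<close>

type_synonym ('i, 'a) condition = "fm \<times> 'i list \<times> 'a list"

definition conditions :: "'i set \<Rightarrow> 'a set \<Rightarrow> ('i, 'a) condition set" where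
  "conditions I D = {(\<phi>, is, es). set is \<subseteq> I \<and> set es \<subseteq> D \<and>
     fm_of_arity (length is + length es) \<phi>}"

definition realizes :: "'a metric \<Rightarrow> 'i set \<Rightarrow> ('i \<Rightarrow> 'a) \<Rightarrow> ('i, 'a) condition set \<Rightarrow> bool" where
  "realizes M I f \<Gamma> \<longleftrightarrow> f ` I \<subseteq> mspace M \<and>
     (\<forall>(\<phi>, is, es)\<in>\<Gamma>. val_at M \<phi> (map f is @ es) = 0)"

definition satisfiable :: "'a metric \<Rightarrow> 'i set \<Rightarrow> ('i, 'a) condition set \<Rightarrow> bool" where
  "satisfiable M I \<Gamma> \<longleftrightarrow> (\<exists>f. realizes M I f \<Gamma>)"

definition tp :: "'a metric \<Rightarrow> 'i set \<Rightarrow> ('i \<Rightarrow> 'a) \<Rightarrow> 'a set \<Rightarrow> ('i, 'a) condition set" where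
  "tp M I f D = {(\<phi>, is, es) \<in> conditions I D. val_at M \<phi> (map f is @ es) = 0}"

definition tp_tuple :: "'a metric \<Rightarrow> 'a list \<Rightarrow> 'a set \<Rightarrow> (nat, 'a) condition set" where
  "tp_tuple M as D = tp M {..<length as} (nth as) D"

definition tp_set :: "'a metric \<Rightarrow> 'a set \<Rightarrow> 'a set \<Rightarrow> ('a, 'a) condition set" where
  "tp_set M A D = tp M A id D"

definition saturated :: "'a metric \<Rightarrow> 'k rel \<Rightarrow> bool" where
  "saturated M \<kappa> \<longleftrightarrow> (\<forall>D n. \<forall>\<Gamma>::(nat, 'a) condition set.
     D \<subseteq> mspace M \<longrightarrow> |D| <o \<kappa> \<longrightarrow> \<Gamma> \<subseteq> conditions {..<n} D \<longrightarrow>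
     (\<forall>\<Delta>\<subseteq>\<Gamma>. finite \<Delta> \<longrightarrow> satisfiable M {..<n} \<Delta>) \<longrightarrow> satisfiable M {..<n} \<Gamma>)"

text \<open>
  The least degree of saturation that a monster model must have is \<open>\<aleph>\<^sub>1\<close>; higher degrees
  enter through \<open>small\<close> only.
\<close>

definition monster_model :: "'a metric \<Rightarrow> fm set \<Rightarrow> bool" where
  "monster_model M T \<longleftrightarrow> model_of M T \<and> saturated M (cardSuc natLeq)"

definition dense_in :: "'a metric \<Rightarrow> 'a set \<Rightarrow> 'a set \<Rightarrow> bool" where
  "dense_in M S A \<longleftrightarrow> S \<subseteq> A \<and> A \<subseteq> mtopology_of M closure_of S"

text \<open>
  For \<open>S\<close> a dense subset of \<open>A\<close> of least cardinality, \<open>|S|\<close> is the density character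
  \<open>\<chi>(A)\<close> and \<open>cardSuc |S|\<close> is \<open>\<chi>(A)\<^sup>+\<close>.
\<close>

definition small :: "'a metric \<Rightarrow> 'a set \<Rightarrow> bool" where
  "small M A \<longleftrightarrow> (\<exists>S. dense_in M S A \<and> (\<forall>S'. dense_in M S' A \<longrightarrow> |S| \<le>o |S'| ) \<and>
     saturated M (cardSuc |S| ))"

section \<open>Dividing\<close>

text \<open>
  \<open>\<phi>(x, b)\<close> divides over \<open>C\<close>, where \<open>x\<close> is an \<open>n\<close>-tuple of variables. The \<open>k\<close>-element
  subfamilies are selected by their indices \<open>l\<close>: identifying equal members of the family
  would make a constant sequence witness that every formula divides (with \<open>k = 2\<close>).
\<close>

definition fm_divides :: "'a metric \<Rightarrow> 'a set \<Rightarrow> fm \<Rightarrow> nat \<Rightarrow> 'a list \<Rightarrow> bool" where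
  "fm_divides M C \<phi> n b \<longleftrightarrow> (\<exists>(bs::nat \<Rightarrow> 'a list) (\<epsilon>::real) (k::nat). \<epsilon> > 0 \<and> k > 0 \<and>
     (\<forall>l. length (bs l) = length b \<and> set (bs l) \<subseteq> mspace M \<and>
        tp_tuple M (bs l) C = tp_tuple M b C) \<and>
     (\<forall>K. finite K \<and> card K = k \<longrightarrow>
        \<not> (\<exists>as. length as = n \<and> set as \<subseteq> mspace M \<and>
              (\<forall>l\<in>K. max (val_at M \<phi> (as @ bs l) - \<epsilon>) 0 = 0))))"

definition type_divides ::
    "'a metric \<Rightarrow> 'a set \<Rightarrow> 'i set \<Rightarrow> ('i, 'a) condition set \<Rightarrow> bool" where
  "type_divides M C I \<Gamma> \<longleftrightarrow> (\<exists>\<phi> is b. distinct is \<and> set is \<subseteq> I \<and> set b \<subseteq> mspace M \<and>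
     fm_of_arity (length is + length b) \<phi> \<and> fm_divides M C \<phi> (length is) b \<and>
     (\<forall>f. realizes M I f \<Gamma> \<longrightarrow> val_at M \<phi> (map f is @ b) = 0))"

definition div_indep :: "'a metric \<Rightarrow> 'a set \<Rightarrow> 'a set \<Rightarrow> 'a set \<Rightarrow> bool" where
  "div_indep M A C B \<longleftrightarrow> \<not> type_divides M C A (tp_set M A (B \<union> C))"

section \<open>The Urysohn sphere\<close>

definition isometric_map :: "'a metric \<Rightarrow> 'a set \<Rightarrow> 'b metric \<Rightarrow> ('a \<Rightarrow> 'b) \<Rightarrow> bool" where
  "isometric_map X F Y f \<longleftrightarrow> f ` F \<subseteq> mspace Y \<and>
     (\<forall>x\<in>F. \<forall>y\<in>F. mdist Y (f x) (f y) = mdist X x y)"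

definition ultrahomogeneous :: "'a metric \<Rightarrow> bool" where
  "ultrahomogeneous X \<longleftrightarrow> (\<forall>F f. finite F \<and> F \<subseteq> mspace X \<and> isometric_map X F X f \<longrightarrow>
     (\<exists>g. isometric_map X (mspace X) X g \<and> g ` mspace X = mspace X \<and> (\<forall>x\<in>F. g x = f x)))"

text \<open>
  A separable metric space has at most continuum many points, so it is isometric to a
  metric space whose underlying set is a set of reals.
\<close>

definition universal_separable :: "'a metric \<Rightarrow> bool" where
  "universal_separable X \<longleftrightarrow> (\<forall>Y::real metric.
     separable_space (mtopology_of Y) \<and> (\<forall>x\<in>mspace Y. \<forall>y\<in>mspace Y. mdist Y x y \<le> 1) \<longrightarrow>
     (\<exists>f. isometric_map Y (mspace Y) X f))"

definition urysohn_sphere :: "'a metric \<Rightarrow> bool" where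
  "urysohn_sphere X \<longleftrightarrow> metric_structure X \<and>
     (SUP (x, y)\<in>mspace X \<times> mspace X. mdist X x y) = 1 \<and>
     separable_space (mtopology_of X) \<and> ultrahomogeneous X \<and> universal_separable X"

section \<open>Distances over a set\<close>

text \<open>
  All values lie in \<open>[0,1]\<close>, so inserting \<open>1\<close> below an infimum and \<open>0\<close> below a supremum
  only affects the empty index set.
\<close>

definition trunc_add :: "real \<Rightarrow> real \<Rightarrow> real" where
  "trunc_add r s = min (r + s) 1"

definition dmax :: "'a metric \<Rightarrow> 'a \<Rightarrow> 'a \<Rightarrow> 'a set \<Rightarrow> real" where
  "dmax M b1 b2 C = Inf (insert 1 ((\<lambda>c. trunc_add (mdist M b1 c) (mdist M b2 c)) ` C))"

definition dmin :: "'a metric \<Rightarrow> 'a \<Rightarrow> 'a \<Rightarrow> 'a set \<Rightarrow> real" where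
  "dmin M b1 b2 C = max (Sup (insert 0 ((\<lambda>c. \<bar>mdist M b1 c - mdist M b2 c\<bar>) ` C)))
                        (mdist M b1 b2 / 3)"

end

theory Submission
  imports Defs "HOL-Library.Ramsey"
begin

text \<open>
  In the Urysohn sphere every Katetov function with values in \<open>[0,1]\<close> on a finite set is realized.
  Approximately this is a set of sentences, so by saturation \<open>M\<close> realizes Katetov functions on small
  sets exactly. Hence isometries between subsets of small density extend, and back and forth shows
  that types are determined by distances.

  Call \<open>E\<close> admissible for \<open>b\<^sub>1, b\<^sub>2\<close> over \<open>C\<close> if
  \<open>d\<^sub>m\<^sub>i\<^sub>n(b\<^sub>1,b\<^sub>2/C) \<le> E \<le> d\<^sub>m\<^sub>a\<^sub>x(b\<^sub>1,b\<^sub>2/C)\<close>. Both equalities together say that a value admissible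
  over \<open>C\<close> is admissible over \<open>AC\<close>. If \<open>E\<close> is admissible over \<open>C\<close> only, witnessed by \<open>a \<in> A\<close>, there are
  copies of \<open>b\<^sub>1b\<^sub>2\<close> over \<open>C\<close> with all cross distances \<open>E\<close>, and the distances of \<open>a\<close> to \<open>b\<^sub>1, b\<^sub>2\<close> cannot be
  realized over two of the copies. Conversely, in a sequence of copies of a finite subset of \<open>B\<close>,
  Ramsey's theorem makes all cross distances at least a third of the original ones and hence
  admissible over \<open>C\<close>; admissibility over \<open>AC\<close> is then the triangle inequality for a single tuple having
  its original distances to all copies.
\<close>

section \<open>Formulas and their values\<close>

lemma val_cong:
  "(\<And>i. i \<in> free_vars \<phi> \<Longrightarrow> s i = t i) \<Longrightarrow> val M s \<phi> = val M t \<phi>"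
proof (induction \<phi> arbitrary: s t)
  case (Conn u \<phi>s)
  have "val M s \<phi> = val M t \<phi>" if "\<phi> \<in> set \<phi>s" for \<phi>
    by (rule Conn.IH[OF that], rule Conn.prems) (use that in auto)
  then have "map (val M s) \<phi>s = map (val M t) \<phi>s" by simp
  then show ?case by (simp only: val.simps)
next
  case (SupQ i \<phi>)
  have "val M (s(i := x)) \<phi> = val M (t(i := x)) \<phi>" for x
    by (rule SupQ.IH) (use SupQ.prems in auto)
  then show ?case by simp
next
  case (InfQ i \<phi>)
  have "val M (s(i := x)) \<phi> = val M (t(i := x)) \<phi>" for x
    by (rule InfQ.IH) (use InfQ.prems in auto)
  then show ?case by simp
qed auto

lemma nth_default_in_cube:
  "(\<And>x. x \<in> set xs \<Longrightarrow> 0 \<le> x \<and> x \<le> 1) \<Longrightarrow> nth_default 0 xs \<in> cube (length xs)"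
  by (auto simp: cube_def nth_default_def)

text \<open>\<open>Sup\<close> and \<open>Inf\<close> of reals are informative only on bounded
  nonempty sets; these bounds justify all later reasoning about quantifiers. Connectives preserve
  them because they map the cube into [0,1].\<close>

lemma val_bounds:
  assumes "metric_structure M"
  shows "wf_fm \<phi> \<Longrightarrow> (\<And>i. i \<in> free_vars \<phi> \<Longrightarrow> s i \<in> mspace M) \<Longrightarrow>
    0 \<le> val M s \<phi> \<and> val M s \<phi> \<le> 1"
proof (induction \<phi> arbitrary: s)
  case (Dist i j)
  then show ?case using assms by (auto simp: metric_structure_def)
next
  case (Conn u \<phi>s)
  have "0 \<le> val M s \<phi> \<and> val M s \<phi> \<le> 1" if "\<phi> \<in> set \<phi>s" for \<phi>
    by (rule Conn.IH[OF that]) (use that Conn.prems in auto)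
  then have "nth_default 0 (map (val M s) \<phi>s) \<in> cube (length (map (val M s) \<phi>s))"
    by (intro nth_default_in_cube) auto
  moreover have "u ` cube (length \<phi>s) \<subseteq> {0..1}"
    using Conn.prems(1) by (simp add: connective_def)
  ultimately have "u (nth_default 0 (map (val M s) \<phi>s)) \<in> {0..1}" by auto
  then show ?case by simp
next
  case (SupQ i \<phi>)
  have b: "0 \<le> val M (s(i := x)) \<phi> \<and> val M (s(i := x)) \<phi> \<le> 1" if "x \<in> mspace M" for x
    using SupQ that by auto
  obtain x where x: "x \<in> mspace M" using assms by (auto simp: metric_structure_def)
  have bd: "bdd_above ((\<lambda>x. val M (s(i := x)) \<phi>) ` mspace M)" using b by (auto intro!: bdd_aboveI)
  have "(SUP x\<in>mspace M. val M (s(i := x)) \<phi>) \<le> 1" using b x by (intro cSUP_least) auto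
  moreover have "0 \<le> (SUP x\<in>mspace M. val M (s(i := x)) \<phi>)"
    using order_trans[OF _ cSUP_upper[OF x bd]] b x by blast
  ultimately show ?case by simp
next
  case (InfQ i \<phi>)
  have b: "0 \<le> val M (s(i := x)) \<phi> \<and> val M (s(i := x)) \<phi> \<le> 1" if "x \<in> mspace M" for x
    using InfQ that by auto
  obtain x where x: "x \<in> mspace M" using assms by (auto simp: metric_structure_def)
  have bd: "bdd_below ((\<lambda>x. val M (s(i := x)) \<phi>) ` mspace M)" using b by (auto intro!: bdd_belowI)
  have "0 \<le> (INF x\<in>mspace M. val M (s(i := x)) \<phi>)" using b x by (intro cINF_greatest) auto
  moreover have "(INF x\<in>mspace M. val M (s(i := x)) \<phi>) \<le> 1"
    using order_trans[OF cINF_lower[OF bd x]] b x by blast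
  ultimately show ?case by simp
qed

section \<open>Universal closure of a condition\<close>

fun sups :: "nat \<Rightarrow> fm \<Rightarrow> fm" where
  "sups 0 \<phi> = \<phi>"
| "sups (Suc n) \<phi> = SupQ n (sups n \<phi>)"

lemma wf_sups [simp]: "wf_fm (sups n \<phi>) = wf_fm \<phi>"
  by (induction n) auto

lemma free_vars_sups [simp]: "free_vars (sups n \<phi>) = free_vars \<phi> - {..<n}"
proof (induction n)
  case (Suc n)
  show ?case unfolding sups.simps free_vars.simps lessThan_Suc Suc by blast
qed simp

text \<open>A supremum of nonnegative numbers vanishes exactly when all of them do. Thus a
  universally quantified condition is again a condition, the form in which facts pass from
  \<open>U\<close> to \<open>M\<close>.\<close>

lemma val_sups_eq_0_iff:
  assumes M: "metric_structure M" and wf: "wf_fm \<phi>"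
    and s: "range s \<subseteq> mspace M"
  shows "val M s (sups n \<phi>) = 0 \<longleftrightarrow>
    (\<forall>t. range t \<subseteq> mspace M \<and> (\<forall>i\<ge>n. t i = s i) \<longrightarrow> val M t \<phi> = 0)"
  using s
proof (induction n arbitrary: s)
  case 0
  have "t = s" if "\<forall>i\<ge>0. t i = s i" for t using that by auto
  then show ?case using 0 by auto
next
  case (Suc n)
  have b: "0 \<le> val M (s(n := x)) (sups n \<phi>)" "val M (s(n := x)) (sups n \<phi>) \<le> 1"
    if "x \<in> mspace M" for x
    using val_bounds[OF M, of "sups n \<phi>" "s(n := x)"] that wf Suc.prems by (auto simp: image_subset_iff)
  have bd: "bdd_above ((\<lambda>x. val M (s(n := x)) (sups n \<phi>)) ` mspace M)"
    using b by (auto intro!: bdd_aboveI)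
  have ne: "mspace M \<noteq> {}" using M by (auto simp: metric_structure_def)
  have "val M s (sups (Suc n) \<phi>) = 0 \<longleftrightarrow> (\<forall>x\<in>mspace M. val M (s(n := x)) (sups n \<phi>) = 0)"
  proof
    assume "val M s (sups (Suc n) \<phi>) = 0"
    then show "\<forall>x\<in>mspace M. val M (s(n := x)) (sups n \<phi>) = 0"
      using cSUP_upper[OF _ bd] b by (force intro: antisym)
  next
    assume "\<forall>x\<in>mspace M. val M (s(n := x)) (sups n \<phi>) = 0"
    then show "val M s (sups (Suc n) \<phi>) = 0" using ne by simp
  qed
  also have "\<dots> \<longleftrightarrow> (\<forall>x\<in>mspace M. \<forall>t. range t \<subseteq> mspace M \<and> (\<forall>i\<ge>n. t i = (s(n := x)) i) \<longrightarrow> val M t \<phi> = 0)"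
    by (rule ball_cong[OF refl], rule Suc.IH) (use Suc.prems in auto)
  also have "\<dots> \<longleftrightarrow> (\<forall>t. range t \<subseteq> mspace M \<and> (\<forall>i\<ge>Suc n. t i = s i) \<longrightarrow> val M t \<phi> = 0)"
  proof (intro iffI allI ballI impI)
    fix t assume a: "\<forall>x\<in>mspace M. \<forall>t. range t \<subseteq> mspace M \<and> (\<forall>i\<ge>n. t i = (s(n := x)) i) \<longrightarrow> val M t \<phi> = 0"
      and t: "range t \<subseteq> mspace M \<and> (\<forall>i\<ge>Suc n. t i = s i)"
    have "\<forall>i\<ge>n. t i = (s(n := t n)) i" using t by (simp add: Suc_le_eq)
    then show "val M t \<phi> = 0" using a t by blast
  next
    fix x t assume a: "\<forall>t. range t \<subseteq> mspace M \<and> (\<forall>i\<ge>Suc n. t i = s i) \<longrightarrow> val M t \<phi> = 0"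
      and t: "range t \<subseteq> mspace M \<and> (\<forall>i\<ge>n. t i = (s(n := x)) i)"
    have "\<forall>i\<ge>Suc n. t i = s i" using t by auto
    then show "val M t \<phi> = 0" using a t by blast
  qed
  finally show ?case .
qed

text \<open>The amount by which values \<open>a\<close>, \<open>b\<close> at two points of distance
  \<open>t\<close> fail the Katetov inequalities \<open>\<bar>a - b\<bar> \<le> t\<close> and
  \<open>t \<le> a + b\<close>.\<close>

definition violation :: "real \<Rightarrow> real \<Rightarrow> real \<Rightarrow> real" where
  "violation a b t = max 0 (max (\<bar>a - b\<bar> - t) (t - a - b))"

text \<open>Turns a continuous expression into a connective. It vanishes exactly where the
  expression is at most 0, so inequalities become conditions.\<close>

definition clip :: "real \<Rightarrow> real" where
  "clip t = max 0 (min 1 t)"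

lemma connective_clip:
  assumes "continuous_on (cube n) f"
  shows "connective n (\<lambda>v. clip (f v))"
  unfolding connective_def clip_def by (auto intro!: continuous_intros assms)

lemma continuous_on_coordinate [continuous_intros]:
  "continuous_on S (\<lambda>v::nat \<Rightarrow> real. v i)"
  by (rule continuous_on_subset[OF continuous_on_product_coordinates]) simp

text \<open>
  The argument \<open>v (i * Suc n + j)\<close> of the connective is the distance \<open>d(x\<^sub>i,x\<^sub>j)\<close>, and \<open>x\<^sub>n\<close> is the
  new point.
\<close>

definition ext_fm :: "nat \<Rightarrow> (nat \<Rightarrow> real) \<Rightarrow> fm" where
  "ext_fm n r = InfQ n (Conn
     (\<lambda>v. clip ((\<Sum>i<n. \<bar>v (i * Suc n + n) - r i\<bar>) -
              real n * (\<Sum>i<n. \<Sum>j<n. violation (r i) (r j) (v (i * Suc n + j)))))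
     (map (\<lambda>k. Dist (k div Suc n) (k mod Suc n)) [0..<Suc n * Suc n]))"

lemma wf_ext_fm: "wf_fm (ext_fm n r)"
  unfolding ext_fm_def
  by (auto intro!: connective_clip continuous_intros simp: violation_def)

lemma free_vars_ext_fm: "free_vars (ext_fm n r) \<subseteq> {..<n}"
proof -
  have "k div Suc n < Suc n" "k mod Suc n < Suc n" if "k < Suc n * Suc n" for k
    using that less_mult_imp_div_less[of k "Suc n" "Suc n"] mod_less_divisor[of "Suc n" k]
    by simp_all
  then have "(\<Union>k\<in>{0..<Suc n * Suc n}. {k div Suc n, k mod Suc n}) \<subseteq> {..<Suc n}"
    by (intro UN_least) (simp only: atLeastLessThan_iff insert_subset lessThan_iff empty_subsetI conj_assoc)
  then have "(\<Union>k\<in>{0..<Suc n * Suc n}. {k div Suc n, k mod Suc n}) - {n} \<subseteq> {..<n}"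
    by (simp only: lessThan_Suc) blast
  then show ?thesis
    by (simp only: ext_fm_def free_vars.simps set_map set_upt image_image UN_simps)
qed

text \<open>The infimum vanishes if points \<open>y\<close> realize the distances \<open>r i\<close>
  with total error arbitrarily close to \<open>n\<close> times the total violation, or below it.
  Subtracting the violation makes the condition true of all tuples, so it can be closed to a
  sentence.\<close>

lemma val_ext_fm:
  "val M s (ext_fm n r) = (INF y\<in>mspace M. clip ((\<Sum>i<n. \<bar>mdist M (s i) y - r i\<bar>) -
     real n * (\<Sum>i<n. \<Sum>j<n. violation (r i) (r j) (mdist M (s i) (s j)))))"
proof -
  have nth: "nth_default 0 (map (\<lambda>\<phi>. val M t \<phi>) (map (\<lambda>k. Dist (k div Suc n) (k mod Suc n)) [0..<Suc n * Suc n]))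
     (i * Suc n + j) = mdist M (t i) (t j)" if "i \<le> n" "j \<le> n" for i j t
  proof -
    have "i * Suc n + j < Suc n * Suc n"
      using that mult_le_mono1[of i n "Suc n"] by simp
    moreover have "(i * Suc n + j) div Suc n = i" "(i * Suc n + j) mod Suc n = j"
      using that by (simp_all only: div_mult_self3 mod_mult_self3 ) auto
    ultimately show ?thesis by (simp add: nth_default_def del: mult_Suc mult_Suc_right upt_Suc)
  qed
  show ?thesis
    unfolding ext_fm_def val.simps
    by (intro INF_cong refl arg_cong[of _ _ clip] arg_cong2[of _ _ _ _ "(-)"] sum.cong
        arg_cong2[of _ _ _ _ "(*)"] arg_cong[of _ _ abs] arg_cong[of _ _ "violation _ _"])
      (subst nth; simp)+
qed

section \<open>Approximate one-point extensions\<close>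

lemma mdist_same [simp]: "x \<in> mspace M \<Longrightarrow> mdist M x x = 0"
  by simp

text \<open>Universality provides a copy of \<open>F\<close> together with a new point at the
  prescribed distances; ultrahomogeneity then moves the copy back onto \<open>F\<close>.\<close>

lemma urysohn_ext:
  assumes U: "urysohn_sphere U" and F: "finite F" "F \<subseteq> mspace U"
    and f1: "\<And>x. x \<in> F \<Longrightarrow> f x \<le> 1"
    and f2: "\<And>x y. x \<in> F \<Longrightarrow> y \<in> F \<Longrightarrow> \<bar>f x - f y\<bar> \<le> mdist U x y \<and> mdist U x y \<le> f x + f y"
  shows "\<exists>y\<in>mspace U. \<forall>x\<in>F. mdist U y x = f x"
proof (cases "\<exists>x\<in>F. f x \<le> 0")
  case True
  \<comment> \<open>A value 0 forces \<open>x\<close> itself to be the point. Otherwise all values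
    are positive and the extended space is a genuine metric space.\<close>
  then obtain x where x: "x \<in> F" "f x \<le> 0" by auto
  have "f x \<ge> 0" using f2[OF x(1) x(1)] mdist_nonneg[of U x x] by linarith
  then have "mdist U x z = f z" if "z \<in> F" for z using f2[OF x(1) that] x(2) by linarith
  then show ?thesis using x F by blast
next
  case False
  define n where "n = card F"
  obtain h where h: "bij_betw h {..<n} F"
    using ex_bij_betw_nat_finite[OF F(1)] unfolding n_def lessThan_atLeast0 by blast
  have hF: "h i \<in> F" if "i < n" for i using h that by (auto simp: bij_betw_def)
  have hU: "h i \<in> mspace U" if "i < n" for i using hF[OF that] F by auto
  have hinj: "h i = h j \<longleftrightarrow> i = j" if "i < n" "j < n" for i j
    using h that by (auto simp: bij_betw_def inj_on_def)
  \<comment> \<open>Indices below \<open>n\<close> name the points of \<open>F\<close>, and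
    \<open>n\<close> names the new point. The absolute values keep \<rho> nonnegative outside
    \<open>{..n}\<close> as well, since \<open>Metric_space\<close> demands this of all
    arguments.\<close>
  define \<rho> where "\<rho> i j = (if i = j then 0 else if i = n then \<bar>f (h j)\<bar>
     else if j = n then \<bar>f (h i)\<bar> else mdist U (h i) (h j))" for i j
  have fpos: "f (h i) > 0" "\<bar>f (h i)\<bar> = f (h i)" if "i < n" for i using False hF[OF that] by force+
  have tri: "\<rho> i k \<le> \<rho> i j + \<rho> j k" if "i \<le> n" "j \<le> n" "k \<le> n" for i j k
  proof -
    have "i < n \<or> i = n" "j < n \<or> j = n" "k < n \<or> k = n" using that by auto
    then show ?thesis
      using f2[OF hF hF, of i j] f2[OF hF hF, of i k] f2[OF hF hF, of j k] fpos[of i] fpos[of j] fpos[of k]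
        mdist_triangle[of "h i" U "h j" "h k"] hU[of i] hU[of j] hU[of k]
        mdist_commute[of U "h i" "h j"] mdist_commute[of U "h i" "h k"] mdist_commute[of U "h j" "h k"]
      unfolding \<rho>_def by (smt (verit) mdist_nonneg)
  qed
  have le1: "\<rho> i j \<le> 1" if "i \<le> n" "j \<le> n" for i j
    using that f1[OF hF, of i] f1[OF hF, of j] fpos[of i] fpos[of j] hU[of i] hU[of j] U
    by (auto simp: \<rho>_def urysohn_sphere_def metric_structure_def le_less)
  have zero: "\<rho> i j = 0 \<longleftrightarrow> i = j" if "i \<le> n" "j \<le> n" for i j
    using that fpos[of i] fpos[of j] hU[of i] hU[of j] hinj[of i j]
    by (auto simp: \<rho>_def le_less)
  \<comment> \<open>Universality is stated for sets of reals, so the index \<open>i\<close> is coded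
    as \<open>real i\<close>.\<close>
  define d where "d a b = \<rho> (nat \<lfloor>a\<rfloor>) (nat \<lfloor>b\<rfloor>)" for a b :: real
  have d: "d (real i) (real j) = \<rho> i j" for i j by (simp add: d_def)
  have Y: "Metric_space (real ` {..n}) d"
  proof
    show "0 \<le> d x y" for x y by (simp add: d_def \<rho>_def)
    show "d x y = d y x" for x y by (simp add: d_def \<rho>_def mdist_commute)
  qed (auto simp: d zero tri)
  define Y where "Y = metric (real ` {..n}, d)"
  have Yd: "mspace Y = real ` {..n}" "mdist Y = d"
    by (simp_all add: Y_def Metric_space.mspace_metric[OF Y] Metric_space.mdist_metric[OF Y])
  have "separable_space (mtopology_of Y)"
    unfolding separable_space_def by (rule exI[of _ "mspace Y"]) (simp add: Yd, metis Yd(1) closure_of_topspace topspace_mtopology_of)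
  then obtain e where e: "isometric_map Y (mspace Y) U e"
  proof -
    have "\<forall>x\<in>mspace Y. \<forall>y\<in>mspace Y. mdist Y x y \<le> 1" by (auto simp: Yd d le1)
    then show ?thesis
      using U \<open>separable_space (mtopology_of Y)\<close> that
      unfolding urysohn_sphere_def universal_separable_def by blast
  qed
  have eU: "e (real i) \<in> mspace U" if "i \<le> n" for i
    using e that by (auto simp: isometric_map_def Yd)
  have ed: "mdist U (e (real i)) (e (real j)) = \<rho> i j" if "i \<le> n" "j \<le> n" for i j
    using e that by (simp add: isometric_map_def Yd d)
  have einj: "inj_on (\<lambda>i. e (real i)) {..<n}"
    using ed zero eU by (intro inj_onI) (metis less_imp_le lessThan_iff mdist_zero)
  \<comment> \<open>\<open>k\<close> sends the copy of \<open>F\<close> back to \<open>F\<close>;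
    the image of \<open>e (real n)\<close> under an extension of \<open>k\<close> is the required
    point.\<close>
  define k where "k z = h (the_inv_into {..<n} (\<lambda>i. e (real i)) z)" for z
  have k: "k (e (real i)) = h i" if "i < n" for i
    using the_inv_into_f_f[OF einj, of i] that by (simp add: k_def)
  define F' where "F' = (\<lambda>i. e (real i)) ` {..<n}"
  have "isometric_map U F' U k"
    unfolding isometric_map_def F'_def by (auto simp: k hU ed) (auto simp: \<rho>_def hU)
  moreover have "finite F'" "F' \<subseteq> mspace U" using eU by (auto simp: F'_def)
  ultimately obtain g where g: "isometric_map U (mspace U) U g" "\<forall>x\<in>F'. g x = k x"
    using U unfolding urysohn_sphere_def ultrahomogeneous_def by meson
  define y where "y = g (e (real n))"
  have gh: "g (e (real i)) = h i" if "i < n" for i using g(2) that k[OF that] by (auto simp: F'_def)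
  have "mdist U y (h i) = f (h i)" if "i < n" for i
  proof -
    have "mdist U y (h i) = mdist U (g (e (real n))) (g (e (real i)))" by (simp add: y_def gh[OF that])
    also have "\<dots> = \<rho> n i" using g(1) eU ed that by (simp add: isometric_map_def)
    finally show ?thesis using that fpos[OF that] by (simp add: \<rho>_def)
  qed
  moreover have "y \<in> mspace U" using g(1) eU[of n] by (auto simp: y_def isometric_map_def)
  ultimately show ?thesis using h by (metis (no_types, lifting) bij_betw_imp_surj_on image_iff lessThan_iff)
qed

section \<open>Values that are Katetov up to an error\<close>

lemma violation_nonneg: "0 \<le> violation a b t"
  by (simp add: violation_def)

text \<open>The values \<open>r\<close> are moved by at most \<open>\<delta>\<close> to a Katetov function of the points \<open>x\<^sub>i\<close>.\<close>

lemma urysohn_ext_approx: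
  fixes n :: nat
  assumes U: "urysohn_sphere U" and x: "\<And>i. i < n \<Longrightarrow> x i \<in> mspace U"
    and r: "\<And>i. i < n \<Longrightarrow> r i \<le> 1"
  shows "\<exists>y\<in>mspace U. (\<Sum>i<n. \<bar>mdist U (x i) y - r i\<bar>) \<le>
     real n * (\<Sum>i<n. \<Sum>j<n. violation (r i) (r j) (mdist U (x i) (x j)))"
proof -
  define \<delta> where "\<delta> = (\<Sum>i<n. \<Sum>j<n. violation (r i) (r j) (mdist U (x i) (x j)))"
  have \<delta>: "violation (r i) (r j) (mdist U (x i) (x j)) \<le> \<delta>" if "i < n" "j < n" for i j
  proof -
    have "violation (r i) (r j) (mdist U (x i) (x j)) \<le> (\<Sum>j<n. violation (r i) (r j) (mdist U (x i) (x j)))"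
      using that by (intro member_le_sum) (auto simp: violation_nonneg)
    also have "\<dots> \<le> \<delta>" unfolding \<delta>_def
      using that by (intro member_le_sum[of i]) (auto simp: violation_nonneg intro: sum_nonneg)
    finally show ?thesis .
  qed
  have v1: "\<bar>r i - r j\<bar> \<le> mdist U (x i) (x j) + \<delta>" and v2: "mdist U (x i) (x j) \<le> r i + r j + \<delta>"
    if "i < n" "j < n" for i j using \<delta>[OF that] by (auto simp: violation_def)
  have \<delta>0: "0 \<le> \<delta>" by (auto simp: \<delta>_def violation_nonneg intro!: sum_nonneg)
  \<comment> \<open>\<open>f\<close> is the largest 1-Lipschitz function that is at most 1
    everywhere and at most \<open>r j + \<delta>\<close> at \<open>x j\<close>. The summand \<delta>
    absorbs the violations: it gives \<open>r i \<le> f (x i)\<close> and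
    \<open>d(z,w) \<le> f z + f w\<close>. As \<open>f\<close> is a function of points, repetitions
    among the \<open>x i\<close> cause no conflict.\<close>
  define g where "g z j = mdist U z (x j) + r j + \<delta>" for z j
  define f where "f z = Min (insert 1 (g z ` {..<n}))" for z
  have f_le: "f z \<le> 1" "j < n \<Longrightarrow> f z \<le> g z j" for z j by (auto simp: f_def)
  have f_ge: "c \<le> f z" if "c \<le> 1" "\<And>j. j < n \<Longrightarrow> c \<le> g z j" for c z using that by (auto simp: f_def)
  have f_cases: "f z = 1 \<or> (\<exists>j<n. f z = g z j)" for z
    using Min_in[of "insert 1 (g z ` {..<n})"] by (auto simp: f_def)
  have lip: "f z \<le> f w + mdist U z w" if "z \<in> mspace U" "w \<in> mspace U" for z w
    using f_cases[of w]
  proof (elim disjE exE conjE)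
    assume "f w = 1" then show ?thesis using f_le(1)[of z] by (simp add: add_increasing2)
  next
    fix j assume j: "j < n" "f w = g w j"
    then show ?thesis using f_le(2)[OF j(1), of z] mdist_triangle[OF that x[OF j(1)]] by (simp add: g_def)
  qed
  have d1: "mdist U z w \<le> 1" if "z \<in> mspace U" "w \<in> mspace U" for z w
    using that U by (auto simp: urysohn_sphere_def metric_structure_def)
  have xr: "r i \<le> f (x i)" if "i < n" for i
    using v1[OF that] r that by (intro f_ge) (force simp: g_def)+
  have gnn: "0 \<le> g z j" if "j < n" for z j 
    using v2[OF that that] mdist_nonneg[of U "x j" "x j"] mdist_nonneg[of U z "x j"] \<delta>0
    unfolding g_def by linarith
  have fnn: "0 \<le> f z" for z by (rule f_ge) (auto simp: gnn)
  have xr2: "f (x i) \<le> r i + \<delta>" if "i < n" for i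
    using f_le(2)[OF that, of "x i"] x[OF that] by (simp add: g_def)
  have sum: "mdist U z w \<le> f z + f w" if z: "z \<in> mspace U" and w: "w \<in> mspace U" for z w
    using f_cases[of z] f_cases[of w]
  proof (elim disjE exE conjE)
    fix i j assume ij: "i < n" "f z = g z i" "j < n" "f w = g w j"
    have "mdist U z w \<le> mdist U z (x i) + (mdist U (x i) (x j) + mdist U (x j) w)"
      using mdist_triangle[OF z x[OF ij(1)] w] mdist_triangle[OF x[OF ij(1)] x[OF ij(3)] w] by linarith
    then show ?thesis using v2[OF ij(1,3)] ij \<delta>0 by (simp add: g_def mdist_commute)
  qed (use d1[OF z w] fnn[of z] fnn[of w] in linarith)+
  obtain y where y: "y \<in> mspace U" "\<forall>z\<in>x ` {..<n}. mdist U y z = f z"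
    using urysohn_ext[OF U, of "x ` {..<n}" f] x lip sum f_le(1) mdist_commute[of U]
    by (smt (verit) finite_imageI finite_lessThan image_iff lessThan_iff subsetI)
  \<comment> \<open>Each of the \<open>n\<close> errors is at most \<delta>, whence the factor
    \<open>n\<close> in the formula.\<close>
  have "(\<Sum>i<n. \<bar>mdist U (x i) y - r i\<bar>) \<le> (\<Sum>i<n. \<delta>)"
    using y xr xr2 by (intro sum_mono) (force simp: mdist_commute[of U _ y] abs_le_iff diff_le_eq add.commute)
  then show ?thesis using y by (auto simp: \<delta>_def)
qed

text \<open>The closure of \<open>ext_fm n r\<close> belongs to \<open>Th U\<close> and hence holds
  in \<open>M\<close>. For Katetov values the violations vanish and only the error term is
  left.\<close>

lemma model_ext_approx:
  fixes n :: nat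
  assumes U: "urysohn_sphere U" and M: "model_of M (Th U)"
    and x: "\<And>i. i < n \<Longrightarrow> x i \<in> mspace M" and r1: "\<And>i. i < n \<Longrightarrow> r i \<le> 1"
    and r2: "\<And>i j. i < n \<Longrightarrow> j < n \<Longrightarrow>
      \<bar>r i - r j\<bar> \<le> mdist M (x i) (x j) \<and> mdist M (x i) (x j) \<le> r i + r j"
    and e: "e > 0"
  shows "\<exists>y\<in>mspace M. (\<Sum>i<n. \<bar>mdist M (x i) y - r i\<bar>) < e"
proof -
  define \<phi> where "\<phi> = sups n (ext_fm n r)"
  have fv: "free_vars \<phi> = {}" using free_vars_ext_fm[of n r] by (auto simp: \<phi>_def)
  have U': "metric_structure U" using U by (simp add: urysohn_sphere_def)
  have M': "metric_structure M" using M by (simp add: model_of_def)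
  obtain u m where u: "u \<in> mspace U" and m: "m \<in> mspace M"
    using U' M' by (auto simp: metric_structure_def)
  have "val U (\<lambda>_. u) \<phi> = 0"
    unfolding \<phi>_def
  proof (subst val_sups_eq_0_iff[OF U' wf_ext_fm], goal_cases)
    case 2
    show ?case
    proof (intro allI impI, elim conjE)
      fix t :: "nat \<Rightarrow> _" assume "range t \<subseteq> mspace U"
      then have t: "t i \<in> mspace U" for i by auto
      obtain y where y: "y \<in> mspace U" "(\<Sum>i<n. \<bar>mdist U (t i) y - r i\<bar>) \<le>
           real n * (\<Sum>i<n. \<Sum>j<n. violation (r i) (r j) (mdist U (t i) (t j)))"
        using urysohn_ext_approx[OF U, of n t r] t r1 by blast
      have "val U t (ext_fm n r) \<le> 0"
        unfolding val_ext_fm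
        by (rule order_trans[OF cINF_lower[OF _ y(1)]]) (use y(2) in \<open>auto intro!: bdd_belowI[of _ 0] simp: clip_def min_le_iff_disj\<close>)
      then show "val U t (ext_fm n r) = 0"
        using val_bounds[OF U' wf_ext_fm[of n r], of t] t by force
    qed
  qed (use u in auto)
  \<comment> \<open>The assignment \<open>(!) []\<close> need not take values in the space, but
    \<phi> is closed, so any assignment serves.\<close>
  then have "val_at U \<phi> [] = 0"
    unfolding val_at_def by (subst val_cong[of _ _ "\<lambda>_. u"]) (auto simp: fv)
  then have "\<phi> \<in> Th U" by (simp add: Th_def fm_of_arity_def fv) (simp add: \<phi>_def wf_ext_fm)
  then have "val_at M \<phi> [] = 0" using M by (simp add: model_of_def)
  then have "val M (\<lambda>_. m) \<phi> = 0"
    unfolding val_at_def by (subst val_cong[of _ _ "(!) []"]) (auto simp: fv)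
  then have *: "val M t (ext_fm n r) = 0" if "range t \<subseteq> mspace M" "\<forall>i\<ge>n. t i = m" for t
    using that m unfolding \<phi>_def by (subst (asm) val_sups_eq_0_iff[OF M' wf_ext_fm]) auto
  have "val M (\<lambda>i. if i < n then x i else m) (ext_fm n r) = 0"
    using x m by (intro *) auto
  moreover have "violation (r i) (r j) (mdist M (x i) (x j)) = 0" if "i < n" "j < n" for i j
    using r2[OF that] by (auto simp: violation_def)
  ultimately have "(INF y\<in>mspace M. clip (\<Sum>i<n. \<bar>mdist M (x i) y - r i\<bar>)) = 0"
    unfolding val_ext_fm by simp
  \<comment> \<open>Below 1 the upper truncation of \<open>clip\<close> has no effect, hence
    \<open>min e 1\<close>.\<close>
  then have "(INF y\<in>mspace M. clip (\<Sum>i<n. \<bar>mdist M (x i) y - r i\<bar>)) < min e 1"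
    using e by simp
  then obtain y where "y \<in> mspace M" "clip (\<Sum>i<n. \<bar>mdist M (x i) y - r i\<bar>) < min e 1"
    using m by (subst (asm) cINF_less_iff) (auto intro!: bdd_belowI[of _ 0] simp: clip_def)
  then show ?thesis by (intro bexI[of _ y]) (auto simp: clip_def split: if_splits)
qed

section \<open>Saturation and extension of isometries\<close>

definition near_fm :: "real \<Rightarrow> real \<Rightarrow> fm" where
  "near_fm r e = Conn (\<lambda>v. clip (\<bar>v 0 - r\<bar> - e)) [Dist 0 1]"

lemma fm_of_arity_near_fm [simp]: "fm_of_arity (Suc (Suc 0)) (near_fm r e)"
  by (auto simp: fm_of_arity_def near_fm_def intro!: connective_clip continuous_intros)

lemma val_at_near_fm [simp]:
  "val_at M (near_fm r e) [x, y] = 0 \<longleftrightarrow> \<bar>mdist M x y - r\<bar> \<le> e"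
  by (simp add: val_at_def near_fm_def clip_def) linarith

text \<open>Configurations are described by labels with prescribed distances. Distance 0 between
  different labels is allowed, so it need not be decided which of the described points
  coincide.\<close>

definition pseudometric_on :: "'i set \<Rightarrow> ('i \<Rightarrow> 'i \<Rightarrow> real) \<Rightarrow> bool" where
  "pseudometric_on I r \<longleftrightarrow> (\<forall>x\<in>I. r x x = 0) \<and> (\<forall>x\<in>I. \<forall>y\<in>I. r x y = r y x \<and> r x y \<le> 1) \<and>
     (\<forall>x\<in>I. \<forall>y\<in>I. \<forall>z\<in>I. r x z \<le> r x y + r y z)"

definition isom :: "'a metric \<Rightarrow> ('i \<Rightarrow> 'i \<Rightarrow> real) \<Rightarrow> 'i set \<Rightarrow> ('i \<Rightarrow> 'a) \<Rightarrow> bool" where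
  "isom M r I g \<longleftrightarrow> g ` I \<subseteq> mspace M \<and> (\<forall>x\<in>I. \<forall>y\<in>I. mdist M (g x) (g y) = r x y)"

definition density_le :: "'k set \<Rightarrow> ('i \<Rightarrow> 'i \<Rightarrow> real) \<Rightarrow> 'i set \<Rightarrow> bool" where
  "density_le K r I \<longleftrightarrow> (\<exists>S\<subseteq>I. |S| \<le>o |K| \<and> (\<forall>x\<in>I. \<forall>e>0. \<exists>y\<in>S. r x y < e))"

text \<open>Collects the facts about \<open>M\<close> from which the rest is derived: approximate
  one-point extensions, which no longer mention \<open>U\<close>, and saturation over at most
  \<open>|K|\<close> parameters.\<close>

locale saturated_urysohn =
  fixes M :: "'a metric" and K :: "'k set"
  assumes metric_structure: "metric_structure M"
    and ext_approx: "\<And>n x r e. (\<And>i. i < n \<Longrightarrow> x i \<in> mspace M) \<Longrightarrow> (\<And>i. i < n \<Longrightarrow> r i \<le> 1) \<Longrightarrow>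
      (\<And>i j. i < n \<Longrightarrow> j < n \<Longrightarrow>
        \<bar>r i - r j\<bar> \<le> mdist M (x i) (x j) \<and> mdist M (x i) (x j) \<le> r i + r j) \<Longrightarrow>
      e > 0 \<Longrightarrow> \<exists>y\<in>mspace M. (\<Sum>i<(n::nat). \<bar>mdist M (x i) y - r i\<bar>) < e"
    and infinite_K: "infinite K"
    and saturation: "\<And>D n (\<Gamma> :: (nat, 'a) condition set). D \<subseteq> mspace M \<Longrightarrow> |D| \<le>o |K| \<Longrightarrow>
      \<Gamma> \<subseteq> conditions {..<n} D \<Longrightarrow> (\<And>\<Delta>. \<Delta> \<subseteq> \<Gamma> \<Longrightarrow> finite \<Delta> \<Longrightarrow> satisfiable M {..<n} \<Delta>) \<Longrightarrow>
      satisfiable M {..<n} \<Gamma>"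
begin

lemma mdist_le_1: "x \<in> mspace M \<Longrightarrow> y \<in> mspace M \<Longrightarrow> mdist M x y \<le> 1"
  using metric_structure by (auto simp: metric_structure_def)

lemma finite_le_K: "finite S \<Longrightarrow> |S| \<le>o |K|"
  using infinite_K by (metis card_of_ordLeq_infinite card_of_Well_order ordLeq_iff_ordLess_or_ordIso ordLeq_total)

lemma Un_le_K: "|X| \<le>o |K| \<Longrightarrow> |Y| \<le>o |K| \<Longrightarrow> |X \<union> Y| \<le>o |K|"
  by (rule card_of_Un_ordLeq_infinite_Field[OF _ _ _ card_of_Card_order])
    (simp_all add: infinite_K Field_card_of)

text \<open>Realizing the distances up to \<open>1 / Suc k\<close> for every \<open>k\<close> is a
  set of conditions that is finitely satisfiable by \<open>ext_approx\<close>; saturation gives one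
  point for all of them.\<close>

lemma one_point_extension:
  assumes S: "|S| \<le>o |K|" and g: "g ` S \<subseteq> mspace M" and f1: "\<And>i. i \<in> S \<Longrightarrow> f i \<le> 1"
    and f2: "\<And>i j. i \<in> S \<Longrightarrow> j \<in> S \<Longrightarrow>
      \<bar>f i - f j\<bar> \<le> mdist M (g i) (g j) \<and> mdist M (g i) (g j) \<le> f i + f j"
  shows "\<exists>y\<in>mspace M. \<forall>i\<in>S. mdist M y (g i) = f i"
proof -
  define c where "c = (\<lambda>(i, k). (near_fm (f i) (1 / real (Suc k)), [0::nat], [g i]))"
  have "satisfiable M {..<1} (c ` (S \<times> UNIV))"
  proof (rule saturation)
    show "|g ` S| \<le>o |K|" using card_of_image S ordLeq_transitive by blast
    show "c ` (S \<times> UNIV) \<subseteq> conditions {..<1} (g ` S)"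
      by (auto simp: c_def conditions_def)
  next
    fix \<Delta> assume "\<Delta> \<subseteq> c ` (S \<times> UNIV)" "finite \<Delta>"
    then obtain P where P: "finite P" "P \<subseteq> S \<times> UNIV" "\<Delta> = c ` P"
      by (metis finite_subset_image)
    \<comment> \<open>The smallest tolerance that occurs in the finite part; the inserted 1 covers
      the empty part.\<close>
    define e where "e = Min (insert 1 ((\<lambda>(i, k). 1 / real (Suc k)) ` P))"
    have e: "e > 0" unfolding e_def using P(1) by (subst Min_gr_iff) (auto simp del: of_nat_Suc)
    have eP: "e \<le> 1 / real (Suc k)" if "(i, k) \<in> P" for i k
      unfolding e_def using P(1) imageI[OF that, of "\<lambda>(i, k). 1 / real (Suc k)"]
      by (intro Min_le) simp_all
    obtain xs where xs: "set xs = fst ` P" 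
      using finite_list[OF finite_imageI[OF P(1), of fst]] by (elim exE)
    have "set xs \<subseteq> S" using xs P(2) by auto
    then have S': "xs ! i \<in> S" if "i < length xs" for i using nth_mem[OF that] by blast
    obtain y where y: "y \<in> mspace M" "(\<Sum>i<length xs. \<bar>mdist M (g (xs ! i)) y - f (xs ! i)\<bar>) < e"
      using ext_approx[of "length xs" "\<lambda>i. g (xs ! i)" "\<lambda>i. f (xs ! i)" e] S' g f1 f2 e by blast
    have "\<bar>mdist M y (g i) - f i\<bar> \<le> 1 / real (Suc k)" if ik: "(i, k) \<in> P" for i k
    proof -
      have "i \<in> set xs" using xs ik by force
      then obtain l where l: "l < length xs" "xs ! l = i" by (auto simp: in_set_conv_nth)
      have "\<bar>mdist M (g (xs ! l)) y - f (xs ! l)\<bar> \<le> (\<Sum>i<length xs. \<bar>mdist M (g (xs ! i)) y - f (xs ! i)\<bar>)"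
        using l by (intro member_le_sum[of l "{..<length xs}" "\<lambda>i. \<bar>mdist M (g (xs ! i)) y - f (xs ! i)\<bar>"]) auto
      then show ?thesis using y(2) eP[OF ik] l(2) by (simp add: mdist_commute)
    qed
    then show "satisfiable M {..<1} \<Delta>"
      unfolding satisfiable_def realizes_def P(3) using y(1)
      by (intro exI[of _ "\<lambda>_. y"]) (auto simp: c_def)
  qed (use g in auto)
  then obtain h where h: "realizes M {..<1} h (c ` (S \<times> UNIV))" by (auto simp: satisfiable_def)
  have "mdist M (h 0) (g i) = f i" if i: "i \<in> S" for i
  proof -
    have "\<bar>mdist M (h 0) (g i) - f i\<bar> \<le> 1 / real (Suc k)" for k
    proof -
      have "c (i, k) \<in> c ` (S \<times> UNIV)" using i by blast
      then show ?thesis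
        using bspec[OF conjunct2[OF h[unfolded realizes_def]], of "c (i, k)"] by (simp add: c_def)
    qed
    then have "\<bar>mdist M (h 0) (g i) - f i\<bar> \<le> 0"
      using reals_Archimedean[of "\<bar>mdist M (h 0) (g i) - f i\<bar>"]
      by (metis inverse_eq_divide linorder_not_le)
    then show ?thesis by simp
  qed
  moreover have "h 0 \<in> mspace M" using h by (auto simp: realizes_def)
  ultimately show ?thesis by blast
qed

text \<open>Back and forth, by induction on the formula: at a quantifier every choice on one side is
  matched on the other by a one-point extension over the finitely many remaining free
  variables.\<close>

lemma val_isometric:
  assumes "\<And>i. i \<in> free_vars \<phi> \<Longrightarrow> s i \<in> mspace M" "\<And>i. i \<in> free_vars \<phi> \<Longrightarrow> t i \<in> mspace M"
    and "\<And>i j. i \<in> free_vars \<phi> \<Longrightarrow> j \<in> free_vars \<phi> \<Longrightarrow> mdist M (s i) (s j) = mdist M (t i) (t j)"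
  shows "val M s \<phi> = val M t \<phi>"
proof -
  have fin: "finite (free_vars \<phi>)" for \<phi> by (induction \<phi>) auto
  define E where "E V s t \<longleftrightarrow> s ` V \<subseteq> mspace M \<and> t ` V \<subseteq> mspace M \<and>
    (\<forall>i\<in>V. \<forall>j\<in>V. mdist M (s i) (s j) = mdist M (t i) (t j))" for V :: "nat set" and s t
  \<comment> \<open>Variable \<open>i\<close> is removed from the domain of the isometry because the
    quantifier overwrites its value.\<close>
  have step: "\<exists>y\<in>mspace M. E V (s(i := x)) (t(i := y))"
    if E: "E (V - {i}) s t" and x: "x \<in> mspace M" and V: "finite V" for V s t i x
  proof -
    have s: "s j \<in> mspace M" if "j \<in> V - {i}" for j using E that by (auto simp: E_def)
    obtain y where y: "y \<in> mspace M" "\<forall>j\<in>V - {i}. mdist M y (t j) = mdist M x (s j)"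
    proof -
      have "\<exists>y\<in>mspace M. \<forall>j\<in>V - {i}. mdist M y (t j) = mdist M x (s j)"
      proof (rule one_point_extension)
        show "|V - {i}| \<le>o |K|" using V by (intro finite_le_K) simp
        show "t ` (V - {i}) \<subseteq> mspace M" using E by (simp add: E_def)
        show "mdist M x (s j) \<le> 1" if "j \<in> V - {i}" for j using mdist_le_1[OF x s[OF that]] .
        fix j k assume jk: "j \<in> V - {i}" "k \<in> V - {i}"
        have "mdist M (t j) (t k) = mdist M (s j) (s k)" using E jk unfolding E_def by metis
        then show "\<bar>mdist M x (s j) - mdist M x (s k)\<bar> \<le> mdist M (t j) (t k) \<and>
            mdist M (t j) (t k) \<le> mdist M x (s j) + mdist M x (s k)"
          using mdist_triangle[OF x s[OF jk(1)] s[OF jk(2)]] mdist_triangle[OF x s[OF jk(2)] s[OF jk(1)]]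
            mdist_triangle[OF s[OF jk(1)] x s[OF jk(2)]] mdist_commute[of M "s j" "s k"]
            mdist_commute[of M x "s j"] by linarith
      qed
      then show ?thesis using that by blast
    qed
    then show ?thesis using E x by (intro bexI[of _ y]) (auto simp: E_def mdist_commute)
  qed
  have sym: "E V s t \<Longrightarrow> E V t s" for V s t by (auto simp: E_def)
  \<comment> \<open>The two sets of values coincide, which settles suprema and infima alike.\<close>
  have im: "(\<lambda>x. val M (s(i := x)) \<phi>) ` mspace M = (\<lambda>x. val M (t(i := x)) \<phi>) ` mspace M"
    if IH: "\<And>s t. E (free_vars \<phi>) s t \<Longrightarrow> val M s \<phi> = val M t \<phi>" and E: "E (free_vars \<phi> - {i}) s t"
    for \<phi> i s t
  proof -
    have "\<exists>y\<in>mspace M. val M (s(i := x)) \<phi> = val M (t(i := y)) \<phi>"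
      if "x \<in> mspace M" "E (free_vars \<phi> - {i}) s t" for x s t
      using step[OF that(2,1) fin] IH by blast
    then show ?thesis using E sym[OF E] by (fastforce simp: image_iff)
  qed
  have *: "E (free_vars \<phi>) s t \<Longrightarrow> val M s \<phi> = val M t \<phi>" for s t
  proof (induction \<phi> arbitrary: s t)
    case (Conn u \<phi>s)
    have "val M s \<phi> = val M t \<phi>" if "\<phi> \<in> set \<phi>s" for \<phi>
      by (rule Conn.IH[OF that]) (use Conn.prems that in \<open>auto simp: E_def\<close>)
    then have "map (val M s) \<phi>s = map (val M t) \<phi>s" by simp
    then show ?case by (simp only: val.simps)
  next
    case (SupQ i \<phi>)
    show ?case unfolding val.simps by (rule arg_cong[of _ _ Sup], rule im) (use SupQ in auto)
  next
    case (InfQ i \<phi>)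
    show ?case unfolding val.simps by (rule arg_cong[of _ _ Inf], rule im) (use InfQ in auto)
  qed (auto simp: E_def)
  show ?thesis by (rule *) (use assms in \<open>auto simp: E_def\<close>)
qed

lemma val_at_map_isometric:
  assumes "fm_of_arity (length is) \<phi>" "g ` set is \<subseteq> mspace M" "h ` set is \<subseteq> mspace M"
    and "\<And>i j. i \<in> set is \<Longrightarrow> j \<in> set is \<Longrightarrow> mdist M (g i) (g j) = mdist M (h i) (h j)"
  shows "val_at M \<phi> (map g is) = val_at M \<phi> (map h is)"
  unfolding val_at_def
proof (rule val_isometric)
  have *: "i < length is" if "i \<in> free_vars \<phi>" for i using assms(1) that by (auto simp: fm_of_arity_def)
  fix i assume "i \<in> free_vars \<phi>"
  then have i: "i < length is" by (rule *)
  show "map g is ! i \<in> mspace M" "map h is ! i \<in> mspace M" using i assms(2,3) by auto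
  fix j assume "j \<in> free_vars \<phi>"
  then have "j < length is" by (rule *)
  with i show "mdist M (map g is ! i) (map g is ! j) = mdist M (map h is ! i) (map h is ! j)"
    using assms(4) by simp
qed

section \<open>Extension of isometries between sets of small density\<close>

lemma density_le_if_card: "|I| \<le>o |K| \<Longrightarrow> (\<And>x. x \<in> I \<Longrightarrow> r x x = 0) \<Longrightarrow> density_le K r I"
  unfolding density_le_def by (intro exI[of _ I]) force

text \<open>A maximal partial isometry on a dense set \<open>S\<close> of at most \<open>|K|\<close>
  labels is total on \<open>S\<close>, since one-point extensions would enlarge it. Every other
  label is then placed by its distances to the part already built, and density forces the correct
  distances and agreement with \<open>g0\<close>.\<close>

lemma extend_isom:
  assumes r: "pseudometric_on (J \<union> L) r" and J: "density_le K r J" and L: "density_le K r L"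
    and g0: "isom M r J g0"
  obtains g where "isom M r (J \<union> L) g" "\<And>x. x \<in> J \<Longrightarrow> g x = g0 x"
proof -
  have refl: "r x x = 0" and rsym: "r x y = r y x" and r1: "r x y \<le> 1"
    and tri: "r x z \<le> r x y + r y z"
    if "x \<in> J \<union> L" "y \<in> J \<union> L" "z \<in> J \<union> L" for x y z
    using r that unfolding pseudometric_on_def by blast+
  obtain J0 where J0: "J0 \<subseteq> J" "|J0| \<le>o |K|" "\<And>x e. x \<in> J \<Longrightarrow> e > 0 \<Longrightarrow> \<exists>y\<in>J0. r x y < e"
    using J by (auto simp: density_le_def)
  obtain L0 where L0: "L0 \<subseteq> L" "|L0| \<le>o |K|" "\<And>x e. x \<in> L \<Longrightarrow> e > 0 \<Longrightarrow> \<exists>y\<in>L0. r x y < e"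
    using L by (auto simp: density_le_def)
  define S where "S = J0 \<union> L0"
  have S: "S \<subseteq> J \<union> L" "|S| \<le>o |K|"
    unfolding S_def using J0(1,2) L0(1,2) Un_le_K by blast+
  have S_dense: "\<exists>y\<in>S. r x y < e" if "x \<in> J \<union> L" "e > 0" for x e
    using that J0(3) L0(3) unfolding S_def by blast
  \<comment> \<open>Only the values on the dense part \<open>J0\<close> are imposed, as
    \<open>J\<close> itself may have more than \<open>|K|\<close> elements. Partial isometries are
    represented by their graphs, so that a chain has its union as upper bound.\<close>
  define G0 where "G0 = (\<lambda>x. (x, g0 x)) ` J0"
  define \<F> where "\<F> = {G. G0 \<subseteq> G \<and> G \<subseteq> S \<times> mspace M \<and>
    (\<forall>p\<in>G. \<forall>q\<in>G. mdist M (snd p) (snd q) = r (fst p) (fst q))}"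
  have "\<exists>G\<in>\<F>. \<forall>X\<in>\<F>. G \<subseteq> X \<longrightarrow> X = G"
  proof (rule subset_Zorn_nonempty)
    have "G0 \<in> \<F>"
      using g0 J0(1) by (auto simp: \<F>_def G0_def S_def isom_def subset_iff)
    then show "\<F> \<noteq> {}" by blast
  next
    fix \<C> assume \<C>: "\<C> \<noteq> {}" "subset.chain \<F> \<C>"
    have "\<exists>G\<in>\<C>. p \<in> G \<and> q \<in> G" if pq: "p \<in> \<Union>\<C>" "q \<in> \<Union>\<C>" for p q
    proof -
      obtain X Y where XY: "p \<in> X" "X \<in> \<C>" "q \<in> Y" "Y \<in> \<C>" using pq by (elim UnionE)
      then have "X \<subseteq> Y \<or> Y \<subseteq> X" using \<C>(2) by (simp add: subset_chain_def)
      then show ?thesis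
      proof
        assume "X \<subseteq> Y" then show ?thesis using XY by (intro bexI[of _ Y]) auto
      next
        assume "Y \<subseteq> X" then show ?thesis using XY by (intro bexI[of _ X]) auto
      qed
    qed
    moreover have "\<C> \<subseteq> \<F>" using \<C>(2) by (simp add: subset_chain_def)
    ultimately have "\<forall>p\<in>\<Union>\<C>. \<forall>q\<in>\<Union>\<C>. mdist M (snd p) (snd q) = r (fst p) (fst q)"
      unfolding \<F>_def by blast
    then show "\<Union>\<C> \<in> \<F>" using \<C>(1) \<open>\<C> \<subseteq> \<F>\<close> unfolding \<F>_def by blast
  qed
  then obtain G where G: "G \<in> \<F>" and max: "\<And>X. X \<in> \<F> \<Longrightarrow> G \<subseteq> X \<Longrightarrow> X = G" by blast
  have G0: "G0 \<subseteq> G" and GS: "G \<subseteq> S \<times> mspace M"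
    and Gd: "\<And>p q. p \<in> G \<Longrightarrow> q \<in> G \<Longrightarrow> mdist M (snd p) (snd q) = r (fst p) (fst q)"
    using G by (auto simp: \<F>_def)
  \<comment> \<open>Labels at distance 0 have equal images, so \<open>G\<close> is the graph of a
    function on a subset of \<open>S\<close> and has at most \<open>|K|\<close> elements.\<close>
  have "inj_on fst G"
  proof (rule inj_onI)
    fix p q assume pq: "p \<in> G" "q \<in> G" "fst p = fst q"
    have m: "fst p \<in> S" "snd p \<in> mspace M" "snd q \<in> mspace M"
      using pq GS by (auto simp: mem_Times_iff)
    have "r (fst p) (fst p) = 0" using refl[of "fst p"] S(1) m(1) by blast
    then have "mdist M (snd p) (snd q) = 0" using Gd[OF pq(1,2)] pq(3) by simp
    then show "p = q" using pq(3) m by (simp add: prod_eq_iff)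
  qed
  moreover have "fst ` G \<subseteq> S" using GS by auto
  ultimately have "|G| \<le>o |S|" using card_of_ordLeq by blast
  then have GK: "|G| \<le>o |K|" using S(2) by (rule ordLeq_transitive)
  have Gfst: "fst p \<in> J \<union> L" if "p \<in> G" for p using GS S(1) that by force
  have Gext: "\<exists>y\<in>mspace M. \<forall>p\<in>G. mdist M y (snd p) = r x (fst p)" if x: "x \<in> J \<union> L" for x
  proof (rule one_point_extension[OF GK])
    show "snd ` G \<subseteq> mspace M" using GS by auto
    show "r x (fst p) \<le> 1" if "p \<in> G" for p using r1[OF x] Gfst[OF that] by blast
    fix p q assume pq: "p \<in> G" "q \<in> G"
    have p: "fst p \<in> J \<union> L" and q: "fst q \<in> J \<union> L" using Gfst pq by blast+
    show "\<bar>r x (fst p) - r x (fst q)\<bar> \<le> mdist M (snd p) (snd q) \<and>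
         mdist M (snd p) (snd q) \<le> r x (fst p) + r x (fst q)"
      using tri[OF x q p] tri[OF x p q] tri[OF p x q] rsym[OF x p x] rsym[OF q p x]
      by (simp add: Gd[OF pq])
  qed
  have dom: "\<exists>a. (x, a) \<in> G" if x: "x \<in> S" for x
  proof -
    have xJL: "x \<in> J \<union> L" using x S(1) by blast
    obtain y where y: "y \<in> mspace M" "\<forall>p\<in>G. mdist M y (snd p) = r x (fst p)"
      using Gext[OF xJL] by blast
    have "mdist M (snd p) y = r (fst p) x" if "p \<in> G" for p
      using y(2) that rsym[OF xJL Gfst[OF that] xJL] by (simp add: mdist_commute)
    then have "insert (x, y) G \<in> \<F>"
      using G0 GS Gd x y refl[OF xJL xJL xJL] by (auto simp: \<F>_def)
    then show ?thesis using max by blast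
  qed
  \<comment> \<open>The images can be chosen independently of one another, because distances to the
    dense part already determine them.\<close>
  have "\<forall>x. \<exists>y. x \<in> J \<union> L \<longrightarrow> y \<in> mspace M \<and> (\<forall>p\<in>G. mdist M y (snd p) = r x (fst p))"
    using Gext by blast
  then obtain g where g: "\<And>x. x \<in> J \<union> L \<Longrightarrow> g x \<in> mspace M"
    "\<And>x p. x \<in> J \<union> L \<Longrightarrow> p \<in> G \<Longrightarrow> mdist M (g x) (snd p) = r x (fst p)" by metis
  have "mdist M (g x) (g y) = r x y" if xy: "x \<in> J \<union> L" "y \<in> J \<union> L" for x y
  proof -
    have "\<bar>mdist M (g x) (g y) - r x y\<bar> \<le> e" if e: "e > 0" for e
    proof -
      obtain s where s: "s \<in> S" "r x s < e / 2" using S_dense[OF xy(1), of "e/2"] e by auto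
      obtain a where a: "(s, a) \<in> G" using dom[OF s(1)] by blast
      have sJL: "s \<in> J \<union> L" using s S by blast
      have am: "a \<in> mspace M" using a GS by auto
      have "mdist M (g x) a = r x s" "mdist M (g y) a = r y s" using g(2)[OF _ a] xy by auto
      then show ?thesis
        using mdist_triangle[OF g(1)[OF xy(1)] am g(1)[OF xy(2)]]
          mdist_triangle[OF g(1)[OF xy(2)] g(1)[OF xy(1)] am]
          tri[OF xy(1) sJL xy(2)] tri[OF xy(2,1) sJL] rsym[OF xy xy(1)] rsym[OF sJL xy(2) sJL]
          mdist_commute[of M "g y"] s(2)
        by (simp add: mdist_commute)
    qed
    then have "\<bar>mdist M (g x) (g y) - r x y\<bar> \<le> 0" by (rule dense_ge)
    then show ?thesis by simp
  qed
  then have "isom M r (J \<union> L) g" using g(1) by (auto simp: isom_def)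
  moreover have "g x = g0 x" if x: "x \<in> J" for x
  proof -
    have xm: "g x \<in> mspace M" "g0 x \<in> mspace M" using g(1) x g0 by (auto simp: isom_def)
    have "mdist M (g x) (g0 x) \<le> e" if e: "e > 0" for e
    proof -
      obtain s where s: "s \<in> J0" "r x s < e / 2" using J0(3)[OF x, of "e/2"] e by auto
      have "(s, g0 s) \<in> G" using G0 s(1) by (auto simp: G0_def)
      then have "mdist M (g x) (g0 s) = r x s" using g(2)[of x "(s, g0 s)"] x by simp
      moreover have "mdist M (g0 x) (g0 s) = r x s" "g0 s \<in> mspace M"
        using g0 x s(1) J0(1) by (auto simp: isom_def)
      ultimately show ?thesis using mdist_triangle[OF xm(1) _ xm(2), of "g0 s"] s(2)
        by (simp add: mdist_commute)
    qed
    then have "mdist M (g x) (g0 x) \<le> 0" by (rule dense_ge)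
    then have "mdist M (g x) (g0 x) = 0" by (simp add: order_antisym)
    then show ?thesis using xm by simp
  qed
  ultimately show ?thesis using that by blast
qed

end

section \<open>Separated pairs give dividing formulas\<close>

lemma countable_ordLeq_nat:
  assumes "countable S" shows "|S| \<le>o |UNIV :: nat set|"
proof -
  obtain f :: "_ \<Rightarrow> nat" where "inj_on f S" using assms by (auto simp: countable_def)
  then show ?thesis using card_of_ordLeq by blast
qed

context saturated_urysohn
begin

lemma countable_le_K: "countable S \<Longrightarrow> |S| \<le>o |K|"
  using countable_ordLeq_nat infinite_K infinite_iff_card_of_nat ordLeq_transitive by blast

section \<open>Types are determined by distances\<close>

lemma val_at_append_isometric:
  assumes "fm_of_arity (length is + length es) \<phi>" and "s ` set is \<subseteq> mspace M" "t ` set is \<subseteq> mspace M"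
    and "set es \<subseteq> mspace M"
    and ij: "\<And>i j. i \<in> set is \<Longrightarrow> j \<in> set is \<Longrightarrow> mdist M (s i) (s j) = mdist M (t i) (t j)"
    and ie: "\<And>i e. i \<in> set is \<Longrightarrow> e \<in> set es \<Longrightarrow> mdist M (s i) e = mdist M (t i) e"
  shows "val_at M \<phi> (map s is @ es) = val_at M \<phi> (map t is @ es)"
proof -
  \<comment> \<open>Variables become \<open>Inl\<close> labels and parameters \<open>Inr\<close>
    labels, the latter interpreted by themselves on both sides.\<close>
  have "val_at M \<phi> (map (case_sum s id) (map Inl is @ map Inr es)) =
      val_at M \<phi> (map (case_sum t id) (map Inl is @ map Inr es))"
  proof (rule val_at_map_isometric)
    show "case_sum s id ` set (map Inl is @ map Inr es) \<subseteq> mspace M"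
      "case_sum t id ` set (map Inl is @ map Inr es) \<subseteq> mspace M" using assms(2-4) by auto
    fix x y :: "'b + 'a"
    assume "x \<in> set (map Inl is @ map Inr es)" "y \<in> set (map Inl is @ map Inr es)"
    then show "mdist M (case_sum s id x) (case_sum s id y) = mdist M (case_sum t id x) (case_sum t id y)"
      using ij ie mdist_commute[of M] by (auto split: sum.splits)
  qed (use assms(1) in simp)
  then show ?thesis by (simp add: comp_def)
qed

lemma tp_tuple_eqI:
  assumes "length b' = length b" "set b \<subseteq> mspace M" "set b' \<subseteq> mspace M" "C \<subseteq> mspace M"
    and ij: "\<And>i j. i < length b \<Longrightarrow> j < length b \<Longrightarrow> mdist M (b' ! i) (b' ! j) = mdist M (b ! i) (b ! j)"
    and ic: "\<And>i c. i < length b \<Longrightarrow> c \<in> C \<Longrightarrow> mdist M (b' ! i) c = mdist M (b ! i) c"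
  shows "tp_tuple M b' C = tp_tuple M b C"
proof -
  have "val_at M \<phi> (map ((!) b') is @ es) = val_at M \<phi> (map ((!) b) is @ es)"
    if "(\<phi>, is, es) \<in> conditions {..<length b} C" for \<phi> "is" es
  proof (rule val_at_append_isometric)
    have "set is \<subseteq> {..<length b}" "set es \<subseteq> C" using that by (auto simp: conditions_def)
    then have i: "i < length b" if "i \<in> set is" for i using that by auto
    show "(!) b' ` set is \<subseteq> mspace M" "(!) b ` set is \<subseteq> mspace M"
      using i assms(1-3) by auto
    show "mdist M (b' ! i) (b' ! j) = mdist M (b ! i) (b ! j)" if "i \<in> set is" "j \<in> set is" for i j
      using ij i that by blast
    show "mdist M (b' ! i) e = mdist M (b ! i) e" if "i \<in> set is" "e \<in> set es" for i e
      using ic i that \<open>set es \<subseteq> C\<close> by blast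
    show "set es \<subseteq> mspace M" using \<open>set es \<subseteq> C\<close> assms(4) by blast
  qed (use that in \<open>auto simp: conditions_def\<close>)
  then show ?thesis unfolding tp_tuple_def tp_def assms(1) by (intro Collect_cong) (auto split: prod.splits)
qed

text \<open>With tolerance 0, \<open>near_fm\<close> records an exact distance as a member of the
  type.\<close>

lemma tp_tuple_eqD:
  assumes eq: "tp_tuple M b' C = tp_tuple M b C" and len: "length b' = length b" and i: "i < length b"
  shows "j < length b \<Longrightarrow> mdist M (b' ! i) (b' ! j) = mdist M (b ! i) (b ! j)"
    and "c \<in> C \<Longrightarrow> mdist M (b' ! i) c = mdist M (b ! i) c"
proof -
  assume j: "j < length b"
  have "(near_fm (mdist M (b ! i) (b ! j)) 0, [i, j], []) \<in> tp_tuple M b C"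
    using i j by (simp add: tp_tuple_def tp_def conditions_def)
  then show "mdist M (b' ! i) (b' ! j) = mdist M (b ! i) (b ! j)"
    unfolding eq[symmetric] by (simp add: tp_tuple_def tp_def)
next
  assume c: "c \<in> C"
  have "(near_fm (mdist M (b ! i) c) 0, [i], [c]) \<in> tp_tuple M b C"
    using i c by (simp add: tp_tuple_def tp_def conditions_def)
  then show "mdist M (b' ! i) c = mdist M (b ! i) c"
    unfolding eq[symmetric] by (simp add: tp_tuple_def tp_def)
qed

text \<open>The source of realizations: moving \<open>A\<close> by an isometry that fixes
  \<open>D\<close> keeps all distances within \<open>A\<close> and from \<open>A\<close> to
  \<open>D\<close>, hence all values of formulas.\<close>

lemma realizes_tp_setI:
  assumes "A \<subseteq> mspace M" "D \<subseteq> mspace M" "isom M (mdist M) (A \<union> D) f" "\<And>e. e \<in> D \<Longrightarrow> f e = e"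
  shows "realizes M A f (tp_set M A D)"
proof -
  have d: "mdist M (f x) (f y) = mdist M x y" if "x \<in> A \<union> D" "y \<in> A \<union> D" for x y
    using assms(3) that unfolding isom_def by blast
  have fA: "f ` A \<subseteq> mspace M" using assms(3) by (auto simp: isom_def)
  have "val_at M \<phi> (map f is @ es) = val_at M \<phi> (map id is @ es)"
    if "(\<phi>, is, es) \<in> conditions A D" for \<phi> "is" es
  proof (rule val_at_append_isometric)
    have is_es: "set is \<subseteq> A" "set es \<subseteq> D" using that by (auto simp: conditions_def)
    show "f ` set is \<subseteq> mspace M" "id ` set is \<subseteq> mspace M" "set es \<subseteq> mspace M"
      using is_es fA assms(1,2) by auto
    show "mdist M (f i) (f j) = mdist M (id i) (id j)" if "i \<in> set is" "j \<in> set is" for i j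
      using d[of i j] that is_es by auto
    show "mdist M (f i) e = mdist M (id i) e" if "i \<in> set is" "e \<in> set es" for i e
    proof -
      have "i \<in> A" "e \<in> D" using that is_es by auto
      then show ?thesis using d[of i e] assms(4)[of e] by simp
    qed
  qed (use that in \<open>auto simp: conditions_def\<close>)
  then show ?thesis using fA by (auto simp: realizes_def tp_set_def tp_def)
qed

section \<open>Copies of a pair with prescribed cross distances\<close>

lemma density_le_image:
  assumes "density_le K r I" and "\<And>x y. x \<in> I \<Longrightarrow> y \<in> I \<Longrightarrow> r' (h x) (h y) = r x y"
  shows "density_le K r' (h ` I)"
proof -
  obtain S where S: "S \<subseteq> I" "|S| \<le>o |K|" "\<forall>x\<in>I. \<forall>e>0. \<exists>y\<in>S. r x y < e"
    using assms(1) by (auto simp: density_le_def)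
  have "|h ` S| \<le>o |K|" using card_of_image S(2) by (rule ordLeq_transitive)
  moreover have "\<exists>y\<in>h ` S. r' (h x) y < e" if x: "x \<in> I" and e: "e > 0" for x e
  proof -
    obtain y where "y \<in> S" "r x y < e" using S(3) x e by blast
    then show ?thesis using assms(2)[OF x, of y] S(1) by (intro bexI[of _ "h y"]) auto
  qed
  ultimately show ?thesis unfolding density_le_def using S(1) by (intro exI[of _ "h ` S"]) auto
qed

text \<open>
  The distances within each of the sequences \<open>p\<close>, \<open>q\<close> are chosen to be \<open>\<bar>E - d(b\<^sub>1,b\<^sub>2)\<bar>\<close>, which
  is compatible with every cross distance \<open>E\<close> between \<open>d\<^sub>m\<^sub>i\<^sub>n\<close> and \<open>d\<^sub>m\<^sub>a\<^sub>x\<close>.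
\<close>

lemma spread_sequence:
  assumes b: "b1 \<in> mspace M" "b2 \<in> mspace M" and C: "C \<subseteq> mspace M" "density_le K (mdist M) C"
    and E: "E \<le> 1" "mdist M b1 b2 \<le> 3 * E"
    and EC: "\<And>c. c \<in> C \<Longrightarrow> \<bar>mdist M b1 c - mdist M b2 c\<bar> \<le> E \<and> E \<le> mdist M b1 c + mdist M b2 c"
  obtains p q :: "nat \<Rightarrow> 'a" where "\<And>l. p l \<in> mspace M" "\<And>l. q l \<in> mspace M"
    "\<And>l. mdist M (p l) (q l) = mdist M b1 b2" "\<And>l m. l \<noteq> m \<Longrightarrow> mdist M (p l) (q m) = E"
    "\<And>l c. c \<in> C \<Longrightarrow> mdist M (p l) c = mdist M b1 c" "\<And>l c. c \<in> C \<Longrightarrow> mdist M (q l) c = mdist M b2 c"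
proof -
  define bb where "bb s = (if s then b1 else b2)" for s
  have bb: "bb s \<in> mspace M" for s using b by (simp add: bb_def)
  define \<delta> where "\<delta> = mdist M b1 b2"
  define \<eta> where "\<eta> = \<bar>E - \<delta>\<bar>"
  \<comment> \<open>The label \<open>(l, s)\<close> is the copy with number \<open>l\<close> of the
    point \<open>bb s\<close>.\<close>
  define \<rho> where "\<rho> l s m t = (if l = m then mdist M (bb s) (bb t) else if s = t then \<eta> else E)"
    for l m :: nat and s t
  define r where "r x y = (case x of
      Inl c \<Rightarrow> (case y of Inl c' \<Rightarrow> mdist M c c' | Inr (m, t) \<Rightarrow> mdist M c (bb t))
    | Inr (l, s) \<Rightarrow> (case y of Inl c' \<Rightarrow> mdist M (bb s) c' | Inr (m, t) \<Rightarrow> \<rho> l s m t))" for x y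
  have E0: "0 \<le> E" "\<delta> \<le> 3 * E" "\<delta> \<le> 1" "0 \<le> \<delta>"
    using E mdist_nonneg[of M b1 b2] mdist_le_1[OF b] unfolding \<delta>_def by linarith+
  have self: "mdist M b1 b1 = 0" "mdist M b2 b2 = 0" "mdist M b1 b2 = \<delta>" "mdist M b2 b1 = \<delta>"
    using b by (auto simp: \<delta>_def mdist_commute)
  \<comment> \<open>The bound \<open>\<eta> \<le> 2 * E\<close> is the triangle of
    \<open>p l\<close>, \<open>q m\<close>, \<open>p n\<close> for three different indices. It rests
    on \<open>\<delta> \<le> 3 * E\<close>, which accounts for the factor 1/3 in
    \<open>dmin\<close>.\<close>
  have \<eta>: "0 \<le> \<eta>" "\<eta> \<le> 1" "\<eta> \<le> \<delta> + E" "\<eta> \<le> 2 * E" "E \<le> \<delta> + \<eta>" "\<delta> \<le> E + \<eta>" using E0 E(1) by (auto simp: \<eta>_def)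
  have \<rho>_tri: "\<rho> l s n u \<le> \<rho> l s m t + \<rho> m t n u" for l s m t n u
    using E0(1,4) \<eta> self unfolding \<rho>_def bb_def
    by (cases s; cases t; cases u; cases "l = m"; cases "m = n"; cases "l = n") simp_all
  have \<rho>_sym: "\<rho> l s m t = \<rho> m t l s" for l s m t
    by (simp add: \<rho>_def mdist_commute)
  have Ct: "\<rho> l s m t \<le> mdist M (bb s) c + mdist M c (bb t)"
    "mdist M (bb s) c \<le> \<rho> l s m t + mdist M (bb t) c" if c: "c \<in> C" for c l s m t
  proof -
    define u v where "u = mdist M b1 c" and "v = mdist M b2 c"
    have c': "c \<in> mspace M" using c C(1) by blast
    have uv: "\<bar>u - v\<bar> \<le> E" "E \<le> u + v" "\<delta> \<le> u + v" "u \<le> \<delta> + v" "v \<le> \<delta> + u" "0 \<le> u" "0 \<le> v"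
      using EC[OF c] mdist_triangle[OF b(1) c' b(2)] mdist_triangle[OF b c'] mdist_triangle[OF b(2,1) c']
        self mdist_commute[of M c b2] by (simp_all add: u_def v_def)
    \<comment> \<open>Triangles through \<open>c\<close> between two copies of one point:
      \<open>E \<le> u + v \<le> \<delta> + 2 * u\<close> and
      \<open>\<delta> \<le> u + v \<le> E + 2 * u\<close>, and likewise for
      \<open>v\<close>.\<close>
    then have "\<eta> \<le> 2 * u" "\<eta> \<le> 2 * v" unfolding \<eta>_def by linarith+
    moreover have "mdist M c b1 = u" "mdist M c b2 = v" "mdist M b1 c = u" "mdist M b2 c = v"
      by (simp_all add: u_def v_def mdist_commute)
    ultimately show "\<rho> l s m t \<le> mdist M (bb s) c + mdist M c (bb t)"
      "mdist M (bb s) c \<le> \<rho> l s m t + mdist M (bb t) c"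
      using uv \<eta>(1) self by (cases s; cases t; cases "l = m"; simp add: \<rho>_def bb_def)+
  qed
  have r: "pseudometric_on (Inl ` C \<union> range Inr) r"
    unfolding pseudometric_on_def
  proof (intro conjI ballI)
    fix x :: "'a + nat \<times> bool" assume "x \<in> Inl ` C \<union> range Inr"
    then show "r x x = 0" using C(1) bb by (auto simp: r_def \<rho>_def split: sum.splits prod.splits)
  next
    fix x y :: "'a + nat \<times> bool" assume "x \<in> Inl ` C \<union> range Inr" "y \<in> Inl ` C \<union> range Inr"
    then show "r x y = r y x" "r x y \<le> 1"
      using subsetD[OF C(1)] bb mdist_le_1 E(1) \<eta>(2) mdist_commute[of M]
      by (auto simp: r_def \<rho>_def split: sum.splits prod.splits)
  next
    fix x y z :: "'a + nat \<times> bool"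
    assume "x \<in> Inl ` C \<union> range Inr" "y \<in> Inl ` C \<union> range Inr" "z \<in> Inl ` C \<union> range Inr"
    \<comment> \<open>The case names mark labels from \<open>C\<close> by c and labels of copies by
      n.\<close>
    then consider (ccc) a b c where "x = Inl a" "y = Inl b" "z = Inl c" "a \<in> C" "b \<in> C" "c \<in> C"
      | (ccn) a b l s where "x = Inl a" "y = Inl b" "z = Inr (l, s)" "a \<in> C" "b \<in> C"
      | (cnc) a c l s where "x = Inl a" "y = Inr (l, s)" "z = Inl c" "a \<in> C" "c \<in> C"
      | (cnn) a l s m t where "x = Inl a" "y = Inr (l, s)" "z = Inr (m, t)" "a \<in> C"
      | (ncc) b c l s where "x = Inr (l, s)" "y = Inl b" "z = Inl c" "b \<in> C" "c \<in> C"
      | (ncn) b l s m t where "x = Inr (l, s)" "y = Inl b" "z = Inr (m, t)" "b \<in> C"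
      | (nnc) c l s m t where "x = Inr (l, s)" "y = Inr (m, t)" "z = Inl c" "c \<in> C"
      | (nnn) l s m t n u where "x = Inr (l, s)" "y = Inr (m, t)" "z = Inr (n, u)"
      by (cases x; cases y; cases z) auto
    then show "r x z \<le> r x y + r y z"
    proof cases
      case cnn
      then show ?thesis
        using Ct(2)[OF cnn(4), where s=t and l=m and t=s and m=l] \<rho>_sym[of m t l s]
          mdist_commute[of M a] by (simp add: r_def)
    next
      case nnc
      then show ?thesis using Ct(2)[OF nnc(4), where s=s and l=l and t=t and m=m] by (simp add: r_def)
    next
      case ncn
      then show ?thesis using Ct(1)[OF ncn(4), where s=s and l=l and t=t and m=m] by (simp add: r_def)
    next
      case nnn
      then show ?thesis using \<rho>_tri by (simp add: r_def)
    qed (use subsetD[OF C(1)] bb in \<open>auto simp: r_def intro!: mdist_triangle\<close>)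
  qed
  have "density_le K r (Inl ` C)" using C(2) by (rule density_le_image) (simp add: r_def)
  moreover have "density_le K r (range Inr)"
    by (intro density_le_if_card countable_le_K) (auto simp: r_def \<rho>_def bb)
  moreover have "isom M r (Inl ` C) projl" using C(1) by (auto simp: isom_def r_def)
  ultimately obtain g where g: "isom M r (Inl ` C \<union> range Inr) g" "\<And>x. x \<in> Inl ` C \<Longrightarrow> g x = projl x"
    using extend_isom[OF r] by blast
  have gd: "mdist M (g x) (g y) = r x y" if "x \<in> Inl ` C \<union> range Inr" "y \<in> Inl ` C \<union> range Inr" for x y
    using g(1) that unfolding isom_def by blast
  have gC: "mdist M (g (Inr (l, s))) c = mdist M (bb s) c" if "c \<in> C" for l s c
    using gd[of "Inr (l, s)" "Inl c"] g(2)[of "Inl c"] that by (simp add: r_def)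
  have gM: "g (Inr x) \<in> mspace M" for x using g(1) by (auto simp: isom_def)
  show ?thesis
  proof (rule that[of "\<lambda>l. g (Inr (l, True))" "\<lambda>l. g (Inr (l, False))"])
  qed (simp_all add: gM gC gd r_def \<rho>_def bb_def)
qed

section \<open>The dividing formula\<close>

definition pair_fm :: "real \<Rightarrow> real \<Rightarrow> fm" where
  "pair_fm s t = Conn (\<lambda>v. clip (max \<bar>v 0 - s\<bar> \<bar>v 1 - t\<bar>)) [Dist 0 1, Dist 0 2]"

lemma fm_of_arity_pair_fm: "fm_of_arity (Suc (Suc (Suc 0))) (pair_fm s t)"
  by (auto simp: fm_of_arity_def pair_fm_def intro!: connective_clip continuous_intros)

lemma val_at_pair_fm:
  "val_at M (pair_fm s t) [x, y, z] = clip (max \<bar>mdist M x y - s\<bar> \<bar>mdist M x z - t\<bar>)"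
  by (simp add: val_at_def pair_fm_def)

text \<open>The formula states the distances \<open>s\<close>, \<open>t\<close> of \<open>a\<close>
  to the pair. Over two different copies from \<open>spread_sequence\<close> it would yield a
  triangle with sides near \<open>s\<close> and \<open>t\<close> and third side \<open>E\<close>,
  which \<open>sep\<close> rules out; so already two instances are inconsistent.\<close>

lemma type_divides_if_separated:
  assumes A: "A \<subseteq> mspace M" "a \<in> A" and D: "D \<subseteq> mspace M"
    and b: "b1 \<in> D" "b2 \<in> D" and C: "C \<subseteq> mspace M" "density_le K (mdist M) C"
    and E: "E \<le> 1" "mdist M b1 b2 \<le> 3 * E"
    and EC: "\<And>c. c \<in> C \<Longrightarrow> \<bar>mdist M b1 c - mdist M b2 c\<bar> \<le> E \<and> E \<le> mdist M b1 c + mdist M b2 c"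
    and sep: "\<not> (\<bar>mdist M b1 a - mdist M b2 a\<bar> \<le> E \<and> E \<le> mdist M b1 a + mdist M b2 a)"
  shows "type_divides M C A (tp_set M A D)"
proof -
  have bM: "b1 \<in> mspace M" "b2 \<in> mspace M" using b D by auto
  define s t where "s = mdist M a b1" and "t = mdist M a b2"
  define \<phi> where "\<phi> = pair_fm s t"
  have sep': "E < \<bar>s - t\<bar> \<or> s + t < E" using sep by (auto simp: s_def t_def mdist_commute)
  obtain p q :: "nat \<Rightarrow> 'a" where pq: "\<And>l. p l \<in> mspace M" "\<And>l. q l \<in> mspace M"
    "\<And>l. mdist M (p l) (q l) = mdist M b1 b2" "\<And>l m. l \<noteq> m \<Longrightarrow> mdist M (p l) (q m) = E"
    "\<And>l c. c \<in> C \<Longrightarrow> mdist M (p l) c = mdist M b1 c" "\<And>l c. c \<in> C \<Longrightarrow> mdist M (q l) c = mdist M b2 c"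
    using spread_sequence[OF bM C E EC] by blast
  \<comment> \<open>A third of the amount by which \<open>E\<close> misses the interval from
    \<open>\<bar>s - t\<bar>\<close> to \<open>s + t\<close>, so that two errors of size \<epsilon>
    do not make up for it. The cap 1/2 keeps \<epsilon> below the truncation of \<open>clip\<close>
    at 1.\<close>
  define \<epsilon> where "\<epsilon> = min (1/2) (max (\<bar>s - t\<bar> - E) (E - (s + t)) / 3)"
  have \<epsilon>: "0 < \<epsilon>" "\<epsilon> \<le> 1/2" "2 * \<epsilon> < \<bar>s - t\<bar> - E \<or> 2 * \<epsilon> < E - (s + t)"
  proof -
    define w where "w = max (\<bar>s - t\<bar> - E) (E - (s + t))"
    have w: "0 < w" "w = \<bar>s - t\<bar> - E \<or> w = E - (s + t)" using sep' by (auto simp: w_def)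
    then show "0 < \<epsilon>" "\<epsilon> \<le> 1/2" by (simp_all add: \<epsilon>_def w_def[symmetric])
    have "2 * \<epsilon> < w" using w(1) by (simp add: \<epsilon>_def w_def[symmetric] min_def)
    then show "2 * \<epsilon> < \<bar>s - t\<bar> - E \<or> 2 * \<epsilon> < E - (s + t)" using w(2) by linarith
  qed
  have "fm_divides M C \<phi> 1 [b1, b2]"
    unfolding fm_divides_def
  proof (intro exI[of _ "\<lambda>l. [p l, q l]"] exI[of _ \<epsilon>] exI[of _ 2] conjI allI impI)
    fix l
    show "tp_tuple M [p l, q l] C = tp_tuple M [b1, b2] C"
    proof (rule tp_tuple_eqI)
      fix i j assume "i < length [b1, b2]" "j < length [b1, b2]"
      then show "mdist M ([p l, q l] ! i) ([p l, q l] ! j) = mdist M ([b1, b2] ! i) ([b1, b2] ! j)"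
        using pq(1-3) bM by (auto simp: less_Suc_eq mdist_commute)
    next
      fix i c assume "i < length [b1, b2]" "c \<in> C"
      then show "mdist M ([p l, q l] ! i) c = mdist M ([b1, b2] ! i) c"
        using pq(5,6) by (auto simp: less_Suc_eq)
    qed (use pq(1,2) bM C(1) in auto)
  next
    fix K :: "nat set" assume "finite K \<and> card K = 2"
    then obtain l m where lm: "K = {l, m}" "l \<noteq> m" by (auto simp: card_2_iff)
    show "\<not> (\<exists>as. length as = 1 \<and> set as \<subseteq> mspace M \<and>
        (\<forall>l\<in>K. max (val_at M \<phi> (as @ [p l, q l]) - \<epsilon>) 0 = 0))"
    proof
      assume "\<exists>as. length as = 1 \<and> set as \<subseteq> mspace M \<and>
        (\<forall>l\<in>K. max (val_at M \<phi> (as @ [p l, q l]) - \<epsilon>) 0 = 0)"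
      then obtain x where x: "x \<in> mspace M" "\<And>l. l \<in> K \<Longrightarrow> max (val_at M \<phi> [x, p l, q l] - \<epsilon>) 0 = 0"
        by (auto simp: length_Suc_conv)
      have "\<bar>mdist M x (p l) - s\<bar> \<le> \<epsilon>" "\<bar>mdist M x (q l) - t\<bar> \<le> \<epsilon>" if "l \<in> K" for l
        using x(2)[OF that] \<epsilon>(2) by (auto simp: \<phi>_def val_at_pair_fm clip_def max_def min_def split: if_splits)
      \<comment> \<open>The two endpoints are taken from different copies, since only cross
        distances equal \<open>E\<close>.\<close>
      then have "\<bar>mdist M x (p l) - s\<bar> \<le> \<epsilon>" "\<bar>mdist M x (q m) - t\<bar> \<le> \<epsilon>" using lm by auto
      moreover have "mdist M (p l) (q m) = E" using pq(4) lm by blast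
      ultimately show False
        using \<epsilon>(3) mdist_triangle[OF pq(1)[of l] x(1) pq(2)[of m]]
          mdist_triangle[OF x(1) pq(1)[of l] pq(2)[of m]] mdist_triangle[OF x(1) pq(2)[of m] pq(1)[of l]]
          mdist_commute[of M x "p l"] mdist_commute[of M "q m" "p l"]
        by linarith
    qed
  qed (use pq(1,2) \<epsilon>(1) in auto)
  moreover have "val_at M \<phi> (map f [a] @ [b1, b2]) = 0" if f: "realizes M A f (tp_set M A D)" for f
  proof -
    have "(\<phi>, [a], [b1, b2]) \<in> tp_set M A D"
      using A(2) b by (simp add: tp_set_def tp_def conditions_def \<phi>_def fm_of_arity_pair_fm val_at_pair_fm
          s_def t_def clip_def)
    then show ?thesis using f by (auto simp: realizes_def)
  qed
  ultimately show ?thesis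
    unfolding type_divides_def
    by (intro exI[of _ \<phi>] exI[of _ "[a]"] exI[of _ "[b1, b2]"])
      (use A bM in \<open>auto simp: \<phi>_def fm_of_arity_pair_fm\<close>)
qed

end

section \<open>Finite supports and common realizations\<close>

context saturated_urysohn
begin

section \<open>Isometries induced by tuples of the same type\<close>

lemma pseudometric_on_mdist: "I \<subseteq> mspace M \<Longrightarrow> pseudometric_on I (mdist M)"
  unfolding pseudometric_on_def
  by (auto simp: mdist_commute subset_iff mdist_le_1 intro!: mdist_triangle)

lemma density_le_Un:
  assumes "density_le K r I" "density_le K r J" shows "density_le K r (I \<union> J)"
proof -
  obtain S where S: "S \<subseteq> I" "|S| \<le>o |K|" "\<And>x e. x \<in> I \<Longrightarrow> e > 0 \<Longrightarrow> \<exists>y\<in>S. r x y < e"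
    using assms(1) by (auto simp: density_le_def)
  obtain T where T: "T \<subseteq> J" "|T| \<le>o |K|" "\<And>x e. x \<in> J \<Longrightarrow> e > 0 \<Longrightarrow> \<exists>y\<in>T. r x y < e"
    using assms(2) by (auto simp: density_le_def)
  have "\<exists>y\<in>S \<union> T. r x y < e" if "x \<in> I \<union> J" "e > 0" for x e
    using that S(3) T(3) by blast
  then show ?thesis
    unfolding density_le_def using S(1) T(1) Un_le_K[OF S(2) T(2)] by (intro exI[of _ "S \<union> T"]) auto
qed

lemma density_le_finite: "finite I \<Longrightarrow> I \<subseteq> mspace M \<Longrightarrow> density_le K (mdist M) I"
  by (rule density_le_if_card) (auto simp: finite_le_K)

lemma tuple_isom:
  assumes len: "length v = length u" and M: "set u \<subseteq> mspace M" "set v \<subseteq> mspace M" "C \<subseteq> mspace M"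
    and ij: "\<And>i j. i < length u \<Longrightarrow> j < length u \<Longrightarrow> mdist M (v ! i) (v ! j) = mdist M (u ! i) (u ! j)"
    and ic: "\<And>i c. i < length u \<Longrightarrow> c \<in> C \<Longrightarrow> mdist M (v ! i) c = mdist M (u ! i) c"
  obtains h where "isom M (mdist M) (C \<union> set u) h" "\<And>c. c \<in> C \<Longrightarrow> h c = c" "map h u = v"
proof -
  \<comment> \<open>The tuple \<open>u\<close> may have repetitions and may meet \<open>C\<close>;
    the choice of index is harmless because distance 0 forces equal images.\<close>
  define h where "h x = (if x \<in> C then x else v ! (SOME i. i < length u \<and> u ! i = x))" for x
  have um: "u ! i \<in> mspace M" and vm: "v ! i \<in> mspace M" if "i < length u" for i
    using M len that by auto
  have hu: "h (u ! i) = v ! i" if i: "i < length u" for i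
  proof (cases "u ! i \<in> C")
    case True
    then have "mdist M (v ! i) (u ! i) = 0" using ic[OF i True] um[OF i] by simp
    then show ?thesis using True um[OF i] vm[OF i] by (simp add: h_def)
  next
    case False
    define j where "j = (SOME j. j < length u \<and> u ! j = u ! i)"
    have j: "j < length u" "u ! j = u ! i"
      using someI[of "\<lambda>j. j < length u \<and> u ! j = u ! i" i] i unfolding j_def by auto
    have "mdist M (v ! j) (v ! i) = 0" using ij[OF j(1) i] j(2) um[OF i] by simp
    then show ?thesis using False vm[OF i] vm[OF j(1)] by (simp add: h_def j_def[symmetric])
  qed
  have hC: "h c = c" if "c \<in> C" for c using that by (simp add: h_def)
  have "isom M (mdist M) (C \<union> set u) h"
    unfolding isom_def
  proof (intro conjI ballI)
    show "h ` (C \<union> set u) \<subseteq> mspace M" using hC hu vm M(3) by (auto simp: in_set_conv_nth)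
    fix x y assume "x \<in> C \<union> set u" "y \<in> C \<union> set u"
    then consider "x \<in> C" "y \<in> C" | i where "i < length u" "x = u ! i" "y \<in> C"
      | i where "x \<in> C" "i < length u" "y = u ! i"
      | i j where "i < length u" "j < length u" "x = u ! i" "y = u ! j"
      by (auto simp: in_set_conv_nth)
    then show "mdist M (h x) (h y) = mdist M x y"
      by cases (simp_all add: hC hu ij ic mdist_commute[of M x])
  qed
  moreover have "map h u = v" using hu len by (intro nth_equalityI) auto
  ultimately show ?thesis using that hC by blast
qed

text \<open>Equal types give an isometry over \<open>C\<close> from \<open>b\<close> to
  \<open>b'\<close>, which \<open>extend_isom\<close> enlarges. Each conjugate of \<open>b\<close>
  thus comes with a matching copy of \<open>F\<close>.\<close>

lemma extend_tp_isom:
  assumes b: "set b \<subseteq> mspace M" "set b' \<subseteq> mspace M" "length b' = length b"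
    and tp: "tp_tuple M b' C = tp_tuple M b C"
    and C: "C \<subseteq> mspace M" "density_le K (mdist M) C" and F: "finite F" "F \<subseteq> mspace M"
  obtains h where "isom M (mdist M) (C \<union> set b \<union> F) h" "\<And>c. c \<in> C \<Longrightarrow> h c = c" "map h b = b'"
proof -
  obtain h0 where h0: "isom M (mdist M) (C \<union> set b) h0" "\<And>c. c \<in> C \<Longrightarrow> h0 c = c" "map h0 b = b'"
    using tuple_isom[OF b(3,1,2) C(1)] tp_tuple_eqD[OF tp b(3)] by metis
  have M: "C \<union> set b \<union> F \<subseteq> mspace M" using b(1) C(1) F(2) by blast
  obtain h where h: "isom M (mdist M) (C \<union> set b \<union> F) h" "\<And>x. x \<in> C \<union> set b \<Longrightarrow> h x = h0 x"
    using extend_isom[OF pseudometric_on_mdist[OF M] density_le_Un[OF C(2) density_le_finite] density_le_finite[OF F] h0(1)]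
      b(1) by auto
  moreover have "map h b = b'" using h(2) h0(3) by (metis UnCI map_eq_conv)
  ultimately show ?thesis using that h0(2) by auto
qed

lemma mdist_eq_on_closure:
  assumes x: "x \<in> mspace M" "y \<in> mspace M" and D: "D \<subseteq> mspace M" "e \<in> D"
    and S: "S \<subseteq> D" "\<And>e \<eta>. e \<in> D \<Longrightarrow> \<eta> > 0 \<Longrightarrow> \<exists>s\<in>S. mdist M e s < \<eta>"
    and eq: "\<And>s. s \<in> S \<Longrightarrow> mdist M x s = mdist M y s"
  shows "mdist M x e = mdist M y e"
proof -
  have "\<bar>mdist M x e - mdist M y e\<bar> \<le> \<eta>" if \<eta>: "\<eta> > 0" for \<eta>
  proof -
    obtain s where s: "s \<in> S" "mdist M e s < \<eta> / 2" using S(2)[OF D(2), of "\<eta> / 2"] \<eta> by auto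
    have m: "e \<in> mspace M" "s \<in> mspace M" using s(1) S(1) D by auto
    show ?thesis
      using mdist_triangle[OF x(1) m] mdist_triangle[OF x(1) m(2,1)] mdist_triangle[OF x(2) m]
        mdist_triangle[OF x(2) m(2,1)] eq[OF s(1)] s(2) mdist_commute[of M e s] by linarith
  qed
  then have "\<bar>mdist M x e - mdist M y e\<bar> \<le> 0" by (rule dense_ge)
  then show ?thesis by simp
qed

text \<open>
  A homogeneous set with \<open>3 d(h\<^sub>l x, h\<^sub>m y) < d(x,y)\<close> for all \<open>l < m\<close> is impossible: for \<open>l < m < n\<close> the
  path \<open>h\<^sub>m x, h\<^sub>n y, h\<^sub>l x, h\<^sub>m y\<close> would be shorter than \<open>d(x,y)\<close>.
\<close>

lemma ramsey_spread:
  fixes h :: "nat \<Rightarrow> 'a \<Rightarrow> 'a"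
  assumes F: "finite F" and h: "\<And>l. isom M (mdist M) F (h l)"
  shows "\<exists>H. infinite H \<and> (\<forall>l\<in>H. \<forall>m\<in>H. l \<noteq> m \<longrightarrow>
    (\<forall>x\<in>F. \<forall>y\<in>F. mdist M x y \<le> 3 * mdist M (h l x) (h m y)))"
proof -
  \<comment> \<open>The colour of a pair of indices is its set of too short pairs, coded by a number
    as \<open>Ramsey2\<close> requires.\<close>
  define bad where "bad l m = {(x, y) \<in> F \<times> F. 3 * mdist M (h l x) (h m y) < mdist M x y}" for l m
  obtain code where "bij_betw code (Pow (F \<times> F)) {0..<card (Pow (F \<times> F))}"
    using ex_bij_betw_finite_nat[of "Pow (F \<times> F)"] F by auto
  then have code: "inj_on code (Pow (F \<times> F))" "\<And>X. X \<subseteq> F \<times> F \<Longrightarrow> code X < card (Pow (F \<times> F))"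
    by (auto simp: bij_betw_def)
  have bad_sub: "bad l m \<subseteq> F \<times> F" for l m by (auto simp: bad_def)
  define col where "col X = code (bad (Min X) (Max X))" for X
  have "\<forall>x\<in>UNIV. \<forall>y\<in>UNIV. x \<noteq> y \<longrightarrow> col {x, y} < card (Pow (F \<times> F))"
    using code(2)[OF bad_sub] by (simp add: col_def)
  from Ramsey2[OF infinite_UNIV_nat this] obtain H t where H: "infinite H"
    "\<And>l m. l \<in> H \<Longrightarrow> m \<in> H \<Longrightarrow> l \<noteq> m \<Longrightarrow> col {l, m} = t" by auto
  have col: "code (bad l m) = t" if "l \<in> H" "m \<in> H" "l < m" for l m
    using H(2)[OF that(1,2)] that(3) by (simp add: col_def)
  have bad_eq: "bad l m = bad l' m'" if "l \<in> H" "m \<in> H" "l < m" "l' \<in> H" "m' \<in> H" "l' < m'" for l m l' m'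
    using code(1) col that bad_sub by (metis PowI inj_onD)
  have hF: "h l x \<in> mspace M" if "x \<in> F" for l x using h that by (auto simp: isom_def)
  have le: "mdist M x y \<le> 3 * mdist M (h l x) (h m y)"
    if lm: "l \<in> H" "m \<in> H" "l < m" and xy: "x \<in> F" "y \<in> F" for l m x y
  proof (rule ccontr)
    assume "\<not> ?thesis"
    then have b: "(x, y) \<in> bad l m" using xy by (simp add: bad_def)
    obtain n where n: "n \<in> H" "m < n" using H(1) unfolding infinite_nat_iff_unbounded by blast
    have "(x, y) \<in> bad m n" "(x, y) \<in> bad l n"
      using b bad_eq[OF lm lm(2) n] bad_eq[OF lm lm(1) n(1)] lm(3) n(2) by auto
    then have "3 * mdist M (h l x) (h m y) < mdist M x y" "3 * mdist M (h m x) (h n y) < mdist M x y"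
      "3 * mdist M (h l x) (h n y) < mdist M x y" using b by (auto simp: bad_def)
    moreover have "mdist M (h m x) (h m y) = mdist M x y" using h xy by (auto simp: isom_def)
    ultimately show False
      using mdist_triangle[OF hF[OF xy(1), of m] hF[OF xy(2), of n] hF[OF xy(2), of m]]
        mdist_triangle[OF hF[OF xy(2), of n] hF[OF xy(1), of l] hF[OF xy(2), of m]]
        mdist_commute[of M "h n y" "h l x"] by linarith
  qed
  have "mdist M x y \<le> 3 * mdist M (h l x) (h m y)"
    if "l \<in> H" "m \<in> H" "l \<noteq> m" "x \<in> F" "y \<in> F" for l m x y
  proof (cases "l < m")
    case False
    \<comment> \<open>For \<open>m < l\<close> the roles of \<open>x\<close> and \<open>y\<close>
      are exchanged.\<close>
    then show ?thesis using le[of m l y x] that by (simp add: mdist_commute)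
  qed (use le that in blast)
  then show ?thesis using H(1) by (intro exI[of _ H]) simp
qed

end

text \<open>The premises on \<open>E\<close> say \<open>d\<^sub>m\<^sub>i\<^sub>n(b\<^sub>1,b\<^sub>2/C) \<le> E \<le> d\<^sub>m\<^sub>a\<^sub>x(b\<^sub>1,b\<^sub>2/C)\<close>.\<close>

definition compatible :: "'a metric \<Rightarrow> 'a set \<Rightarrow> 'a set \<Rightarrow> 'a set \<Rightarrow> bool" where
  "compatible M A B C \<longleftrightarrow> (\<forall>b1\<in>B. \<forall>b2\<in>B. \<forall>a\<in>A. \<forall>E. E \<le> 1 \<and> mdist M b1 b2 \<le> 3 * E \<and>
     (\<forall>c\<in>C. \<bar>mdist M b1 c - mdist M b2 c\<bar> \<le> E \<and> E \<le> mdist M b1 c + mdist M b2 c) \<longrightarrow>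
     \<bar>mdist M b1 a - mdist M b2 a\<bar> \<le> E \<and> E \<le> mdist M b1 a + mdist M b2 a)"

context saturated_urysohn
begin

text \<open>The parameters \<open>b\<close> of a formula that witnesses dividing need not lie in \<open>D\<close>.\<close>

lemma finite_support:
  assumes A: "A \<subseteq> mspace M" "density_le K (mdist M) A" and D: "D \<subseteq> mspace M" "density_le K (mdist M) D"
    and is_b: "set is \<subseteq> A" "set b \<subseteq> mspace M"
    and \<phi>: "fm_of_arity (length is + length b) \<phi>"
    and all: "\<And>f. realizes M A f (tp_set M A D) \<Longrightarrow> val_at M \<phi> (map f is @ b) = 0"
    and \<epsilon>: "\<epsilon> > 0"
  shows "\<exists>F\<subseteq>D. finite F \<and> (\<forall>g. g ` set is \<subseteq> mspace M \<and>
      (\<forall>i\<in>set is. \<forall>j\<in>set is. mdist M (g i) (g j) = mdist M i j) \<and>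
      (\<forall>i\<in>set is. \<forall>e\<in>F. mdist M (g i) e = mdist M i e) \<longrightarrow> val_at M \<phi> (map g is @ b) \<le> \<epsilon>)"
proof (rule ccontr)
  \<comment> \<open>Compactness: if no finite \<open>F\<close> works, saturation yields a tuple with
    the distances of \<open>is\<close> to itself and to \<open>D\<close> at which \<phi> is at least
    \<open>\<epsilon>'\<close>. It extends to a realization of the type of \<open>A\<close>, where
    \<phi> should vanish.\<close>
  assume contra: "\<not> ?thesis"
  define n where "n = length is"
  define \<epsilon>' where "\<epsilon>' = min \<epsilon> 1"
  have \<epsilon>': "0 < \<epsilon>'" "\<epsilon>' \<le> \<epsilon>" "\<epsilon>' \<le> 1" using \<epsilon> by (auto simp: \<epsilon>'_def)
  obtain D0 where D0: "D0 \<subseteq> D" "|D0| \<le>o |K|" "\<And>x e. x \<in> D \<Longrightarrow> e > 0 \<Longrightarrow> \<exists>y\<in>D0. mdist M x y < e"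
    using D(2) by (auto simp: density_le_def)
  define \<psi> where "\<psi> = Conn (\<lambda>v. clip (\<epsilon>' - v 0)) [\<phi>]"
  have "connective 1 (\<lambda>v. clip (\<epsilon>' - v 0))" by (intro connective_clip continuous_intros)
  then have \<psi>: "fm_of_arity (n + length b) \<psi>" using \<phi> by (simp add: \<psi>_def n_def fm_of_arity_def)
  have val_\<psi>: "val_at M \<psi> xs = 0 \<longleftrightarrow> \<epsilon>' \<le> val_at M \<phi> xs" for xs
    by (auto simp: \<psi>_def val_at_def clip_def)
  \<comment> \<open>Parameters come from the dense set \<open>D0\<close>, which is small enough for
    saturation; the distances to the rest of \<open>D\<close> follow by continuity in
    \<open>fie\<close>.\<close>
  define \<Gamma>1 where "\<Gamma>1 = (\<lambda>(i, e). (near_fm (mdist M (is ! i) e) 0, [i], [e])) ` ({..<n} \<times> D0)"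
  define \<Gamma>2 where "\<Gamma>2 = (\<lambda>(i, j). (near_fm (mdist M (is ! i) (is ! j)) 0, [i, j], [] :: 'a list)) ` ({..<n} \<times> {..<n})"
  define \<Gamma> where "\<Gamma> = insert (\<psi>, [0..<n], b) (\<Gamma>1 \<union> \<Gamma>2)"
  have isM: "is ! i \<in> mspace M" if "i < n" for i
    using that subsetD[OF A(1) subsetD[OF is_b(1) nth_mem]] by (simp add: n_def)
  have "satisfiable M {..<n} \<Gamma>"
  proof (rule saturation)
    show "D0 \<union> set b \<subseteq> mspace M" using D0(1) D(1) is_b(2) by blast
    show "|D0 \<union> set b| \<le>o |K|" by (intro Un_le_K D0(2) finite_le_K) simp
    show "\<Gamma> \<subseteq> conditions {..<n} (D0 \<union> set b)"
      by (auto simp: \<Gamma>_def \<Gamma>1_def \<Gamma>2_def conditions_def \<psi>)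
  next
    fix \<Delta> assume \<Delta>: "\<Delta> \<subseteq> \<Gamma>" "finite \<Delta>"
    define F where "F = (\<Union>(\<phi>, is, es)\<in>\<Delta>. set es) \<inter> D0"
    have "finite F" "F \<subseteq> D" using \<Delta>(2) D0(1) by (auto simp: F_def)
    then obtain g where g: "g ` set is \<subseteq> mspace M"
      "\<And>i j. i \<in> set is \<Longrightarrow> j \<in> set is \<Longrightarrow> mdist M (g i) (g j) = mdist M i j"
      "\<And>i e. i \<in> set is \<Longrightarrow> e \<in> F \<Longrightarrow> mdist M (g i) e = mdist M i e" "val_at M \<phi> (map g is @ b) > \<epsilon>"
      using contra by (metis (no_types, lifting) not_le)
    define f where "f i = g (is ! i)" for i
    have map_f: "map f [0..<n] = map g is" by (rule nth_equalityI) (auto simp: f_def n_def)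
    have "val_at M \<theta> (map f js @ es) = 0" if c: "(\<theta>, js, es) \<in> \<Delta>" for \<theta> js es
    proof -
      have "(\<theta>, js, es) \<in> \<Gamma>" using c \<Delta>(1) by blast
      then consider "\<theta> = \<psi>" "js = [0..<n]" "es = b"
        | i e where "i < n" "e \<in> D0" "\<theta> = near_fm (mdist M (is ! i) e) 0" "js = [i]" "es = [e]"
        | i j where "i < n" "j < n" "\<theta> = near_fm (mdist M (is ! i) (is ! j)) 0" "js = [i, j]" "es = []"
        by (auto simp: \<Gamma>_def \<Gamma>1_def \<Gamma>2_def)
      then show ?thesis
      proof cases
        case 1
        then show ?thesis using \<epsilon>'(2) g(4) by (simp add: val_\<psi> map_f)
      next
        case 2
        then have "e \<in> F" using c by (force simp: F_def)
        then show ?thesis using 2 g(3)[of "is ! i" e] by (simp add: f_def n_def)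
      next
        case 3
        then show ?thesis using g(2)[of "is ! i" "is ! j"] by (simp add: f_def n_def)
      qed
    qed
    moreover have "f ` {..<n} \<subseteq> mspace M" using g(1) by (auto simp: f_def n_def)
    ultimately show "satisfiable M {..<n} \<Delta>"
      unfolding satisfiable_def realizes_def by (intro exI[of _ f]) auto
  qed
  then obtain f where f: "f ` {..<n} \<subseteq> mspace M"
    "\<And>\<theta> js es. (\<theta>, js, es) \<in> \<Gamma> \<Longrightarrow> val_at M \<theta> (map f js @ es) = 0"
    unfolding satisfiable_def realizes_def by fast
  have fij: "mdist M (f i) (f j) = mdist M (is ! i) (is ! j)" if "i < n" "j < n" for i j
  proof -
    have "(near_fm (mdist M (is ! i) (is ! j)) 0, [i, j], []) \<in> \<Gamma>" using that by (force simp: \<Gamma>_def \<Gamma>2_def)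
    from f(2)[OF this] show ?thesis by simp
  qed
  have fi0: "mdist M (f i) e = mdist M (is ! i) e" if "i < n" "e \<in> D0" for i e
  proof -
    have "(near_fm (mdist M (is ! i) e) 0, [i], [e]) \<in> \<Gamma>" using that by (force simp: \<Gamma>_def \<Gamma>1_def)
    from f(2)[OF this] show ?thesis by simp
  qed
  have fie: "mdist M (f i) e = mdist M (is ! i) e" if "i < n" "e \<in> D" for i e
    by (rule mdist_eq_on_closure[OF _ isM D(1) _ D0(1,3)]) (use that f(1) fi0 in auto)
  obtain h0 where h0: "isom M (mdist M) (D \<union> set is) h0" "\<And>c. c \<in> D \<Longrightarrow> h0 c = c"
    "map h0 is = map f [0..<n]"
  proof (rule tuple_isom)
    show "set is \<subseteq> mspace M" using is_b(1) A(1) by blast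
    show "set (map f [0..<n]) \<subseteq> mspace M" using f(1) by auto
    show "length (map f [0..<n]) = length is" by (simp add: n_def)
    show "D \<subseteq> mspace M" by (rule D(1))
  qed (use fij fie in \<open>auto simp: n_def\<close>)
  \<comment> \<open>The type concerns all of \<open>A\<close>, so the isometry on the finite tuple
    is extended to \<open>A\<close>.\<close>
  have M: "D \<union> set is \<union> A \<subseteq> mspace M" using D(1) A(1) is_b(1) by blast
  have "density_le K (mdist M) (D \<union> set is)"
    using D(2) by (rule density_le_Un) (use M in \<open>simp add: density_le_finite\<close>)
  then obtain h where h: "isom M (mdist M) (D \<union> set is \<union> A) h" "\<And>x. x \<in> D \<union> set is \<Longrightarrow> h x = h0 x"
    using extend_isom[OF pseudometric_on_mdist[OF M] _ A(2) h0(1)] by blast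
  have "D \<union> set is \<union> A = A \<union> D" using is_b(1) by blast
  then have "realizes M A h (tp_set M A D)"
    using h h0(2) A(1) D(1) by (intro realizes_tp_setI) auto
  then have "val_at M \<phi> (map h is @ b) = 0" by (rule all)
  moreover have "map h is = map f [0..<n]" using h(2) h0(3) by (metis UnCI map_eq_conv)
  moreover have "val_at M \<psi> (map f [0..<n] @ b) = 0" using f(2) by (simp add: \<Gamma>_def)
  ultimately show False using val_\<psi> \<epsilon>'(1) by simp
qed

text \<open>After thinning out by Ramsey, prescribing the original distances from \<open>I\<close>
  to all copies of \<open>F\<close> is a pseudometric: the critical triangles, with two vertices in
  copies, are those of \<open>key\<close>. The copies stay fixed while \<open>extend_isom\<close>
  adds the new tuple.\<close>

lemma common_realization:
  fixes h :: "nat \<Rightarrow> 'a \<Rightarrow> 'a"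
  assumes A: "A \<subseteq> mspace M" and B: "B \<subseteq> mspace M" and C: "C \<subseteq> mspace M"
    and compat: "compatible M A B C"
    and I: "finite I" "I \<subseteq> A" and F: "finite F" "F \<subseteq> B \<union> C"
    and h: "\<And>l. isom M (mdist M) (C \<union> F) (h l)" "\<And>l c. c \<in> C \<Longrightarrow> h l c = c"
  obtains L g where "infinite L" "g ` I \<subseteq> mspace M"
    "\<And>i j. i \<in> I \<Longrightarrow> j \<in> I \<Longrightarrow> mdist M (g i) (g j) = mdist M i j"
    "\<And>i l x. i \<in> I \<Longrightarrow> l \<in> L \<Longrightarrow> x \<in> F \<Longrightarrow> mdist M (g i) (h l x) = mdist M i x"
proof -
  have "isom M (mdist M) F (h l)" for l using h(1)[of l] by (auto simp: isom_def)
  from ramsey_spread[OF F(1), of h, OF this] obtain L where L: "infinite L" "\<forall>l\<in>L. \<forall>m\<in>L. l \<noteq> m \<longrightarrow>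
    (\<forall>x\<in>F. \<forall>y\<in>F. mdist M x y \<le> 3 * mdist M (h l x) (h m y))"
    by (elim exE conjE)
  have hd: "mdist M (h l x) (h l y) = mdist M x y" if "x \<in> C \<union> F" "y \<in> C \<union> F" for l x y
    using h(1) that unfolding isom_def by blast
  have hM: "h l x \<in> mspace M" if "x \<in> F" for l x using h(1)[of l] that by (auto simp: isom_def)
  have IM: "i \<in> mspace M" if "i \<in> I" for i using I A that by blast
  have FM: "x \<in> mspace M" if "x \<in> F" for x using F B C that by blast
  have key: "\<bar>mdist M x i - mdist M y i\<bar> \<le> mdist M (h l x) (h m y) \<and>
      mdist M (h l x) (h m y) \<le> mdist M x i + mdist M y i"
    if i: "i \<in> I" and lm: "l \<in> L" "m \<in> L" and xy: "x \<in> F" "y \<in> F" for i l m x y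
  proof (cases "l = m \<or> x \<in> C \<or> y \<in> C")
    case True
    \<comment> \<open>Within one copy, or if one of the points is fixed, the distance is the
      original one and the claim is the triangle inequality.\<close>
    have "mdist M (h l x) (h m y) = mdist M x y"
      using True hd[of x y m] hd[of x y l] h(2)[of x] h(2)[of y] xy by auto
    then show ?thesis
      using mdist_triangle[OF FM[OF xy(1)] IM[OF i] FM[OF xy(2)]]
        mdist_triangle[OF FM[OF xy(1)] FM[OF xy(2)] IM[OF i]]
        mdist_triangle[OF FM[OF xy(2)] FM[OF xy(1)] IM[OF i]]
        mdist_commute[of M i y] mdist_commute[of M y x] by linarith
  next
    case False
    \<comment> \<open>Now \<open>x\<close> and \<open>y\<close> lie in \<open>B\<close>, and
      \<open>compat\<close> is applied with the cross distance as \<open>E\<close>. It is admissible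
      over \<open>C\<close>: the choice of \<open>L\<close> gives the bound by a third, and the
      isometries fix \<open>C\<close>.\<close>
    show ?thesis
    proof (rule compat[unfolded compatible_def, THEN bspec, THEN bspec, THEN bspec, THEN spec, THEN mp],
        goal_cases)
      case 4
      show ?case
      proof (intro conjI ballI)
        show "mdist M (h l x) (h m y) \<le> 1" by (intro mdist_le_1 hM xy)
        show "mdist M x y \<le> 3 * mdist M (h l x) (h m y)" using L(2) lm False xy by simp
        fix c assume c: "c \<in> C"
        have cM: "c \<in> mspace M" using c C by blast
        have "mdist M (h l x) c = mdist M x c" "mdist M (h m y) c = mdist M y c"
          using hd[of x c l] hd[of y c m] h(2)[OF c] c xy by auto
        then show "\<bar>mdist M x c - mdist M y c\<bar> \<le> mdist M (h l x) (h m y)"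
          "mdist M (h l x) (h m y) \<le> mdist M x c + mdist M y c"
          using mdist_triangle[OF hM[OF xy(1), of l] cM hM[OF xy(2), of m]]
            mdist_triangle[OF hM[OF xy(1), of l] hM[OF xy(2), of m] cM]
            mdist_triangle[OF hM[OF xy(2), of m] hM[OF xy(1), of l] cM]
            mdist_commute[of M c "h m y"] mdist_commute[of M "h m y" "h l x"] by linarith+
      qed
    qed (use False xy F(2) i I(2) in blast)+
  qed
  \<comment> \<open>\<open>Inl i\<close> stands for the new copy of \<open>i\<close>,
    \<open>Inr (l, x)\<close> for the point \<open>h l x\<close>.\<close>
  define r where "r u w = (case u of
      Inl i \<Rightarrow> (case w of Inl j \<Rightarrow> mdist M i j | Inr (m, y) \<Rightarrow> mdist M y i)
    | Inr (l, x) \<Rightarrow> (case w of Inl j \<Rightarrow> mdist M x j | Inr (m, y) \<Rightarrow> mdist M (h l x) (h m y)))"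
    for u w :: "'a + nat \<times> 'a"
  have dom: "u \<in> Inr ` (L \<times> F) \<union> Inl ` I \<longleftrightarrow> (\<exists>i\<in>I. u = Inl i) \<or> (\<exists>l\<in>L. \<exists>x\<in>F. u = Inr (l, x))" for u
    by auto
  have r: "pseudometric_on (Inr ` (L \<times> F) \<union> Inl ` I) r"
    unfolding pseudometric_on_def
  proof (intro conjI ballI)
    fix u assume "u \<in> Inr ` (L \<times> F) \<union> Inl ` I"
    then show "r u u = 0" using IM hM by (auto simp: r_def)
  next
    fix u w assume "u \<in> Inr ` (L \<times> F) \<union> Inl ` I" "w \<in> Inr ` (L \<times> F) \<union> Inl ` I"
    then show "r u w = r w u" "r u w \<le> 1"
      unfolding dom by (auto simp: r_def mdist_commute IM FM hM mdist_le_1)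
  next
    fix u w z assume "u \<in> Inr ` (L \<times> F) \<union> Inl ` I" "w \<in> Inr ` (L \<times> F) \<union> Inl ` I"
      "z \<in> Inr ` (L \<times> F) \<union> Inl ` I"
    then consider (iii) i j k where "u = Inl i" "w = Inl j" "z = Inl k" "i \<in> I" "j \<in> I" "k \<in> I"
      | (iix) i j m y where "u = Inl i" "w = Inl j" "z = Inr (m, y)" "i \<in> I" "j \<in> I" "y \<in> F"
      | (ixi) i j m y where "u = Inl i" "w = Inr (m, y)" "z = Inl j" "i \<in> I" "j \<in> I" "y \<in> F"
      | (xii) i j m y where "u = Inr (m, y)" "w = Inl i" "z = Inl j" "i \<in> I" "j \<in> I" "y \<in> F"
      | (ixx) i l x m y where "u = Inl i" "w = Inr (l, x)" "z = Inr (m, y)"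
          "i \<in> I" "l \<in> L" "m \<in> L" "x \<in> F" "y \<in> F"
      | (xix) i l x m y where "u = Inr (l, x)" "w = Inl i" "z = Inr (m, y)"
          "i \<in> I" "l \<in> L" "m \<in> L" "x \<in> F" "y \<in> F"
      | (xxi) i l x m y where "u = Inr (l, x)" "w = Inr (m, y)" "z = Inl i"
          "i \<in> I" "l \<in> L" "m \<in> L" "x \<in> F" "y \<in> F"
      | (xxx) l x m y n t where "u = Inr (l, x)" "w = Inr (m, y)" "z = Inr (n, t)" "x \<in> F" "y \<in> F" "t \<in> F"
      by (cases u; cases w; cases z) auto
    then show "r u z \<le> r u w + r w z"
    proof cases
      case iix
      then show ?thesis using mdist_triangle[of y M j i] IM FM
        by (simp add: r_def mdist_commute[of M i j] add.commute)
    next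
      case ixi
      then show ?thesis using mdist_triangle[of i M y j] IM FM by (simp add: r_def mdist_commute[of M i y])
    next
      case ixx
      then show ?thesis using key[OF ixx(4-8)] by (simp add: r_def) linarith
    next
      case xix
      then show ?thesis using key[OF xix(4-8)] by (simp add: r_def)
    next
      case xxi
      then show ?thesis using key[OF xxi(4-8)] by (simp add: r_def) linarith
    qed (use IM FM hM in \<open>auto simp: r_def intro!: mdist_triangle\<close>)
  qed
  have "density_le K r (Inr ` (L \<times> F))"
    by (intro density_le_if_card countable_le_K countable_image countable_SIGMA)
      (use F(1) hM in \<open>auto simp: r_def countable_finite\<close>)
  moreover have "density_le K r (Inl ` I)"
    by (intro density_le_if_card finite_le_K) (use I(1) IM in \<open>auto simp: r_def\<close>)
  moreover have "isom M r (Inr ` (L \<times> F)) (\<lambda>u. h (fst (projr u)) (snd (projr u)))"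
    using hM by (auto simp: isom_def r_def)
  ultimately obtain g where g: "isom M r (Inr ` (L \<times> F) \<union> Inl ` I) g"
    "\<And>u. u \<in> Inr ` (L \<times> F) \<Longrightarrow> g u = h (fst (projr u)) (snd (projr u))"
    by (rule extend_isom[OF r]) (rule that)
  have gr: "mdist M (g u) (g w) = r u w"
    if "u \<in> Inr ` (L \<times> F) \<union> Inl ` I" "w \<in> Inr ` (L \<times> F) \<union> Inl ` I" for u w
    using g(1) that unfolding isom_def by blast
  show ?thesis
  proof (rule that[of L "\<lambda>i. g (Inl i)"])
    show "mdist M (g (Inl i)) (g (Inl j)) = mdist M i j" if "i \<in> I" "j \<in> I" for i j
      using gr[of "Inl i" "Inl j"] that by (simp add: r_def)
    show "mdist M (g (Inl i)) (h l x) = mdist M i x" if "i \<in> I" "l \<in> L" "x \<in> F" for i l x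
      using gr[of "Inl i" "Inr (l, x)"] g(2)[of "Inr (l, x)"] that by (simp add: r_def mdist_commute)
  qed (use L(1) g(1) in \<open>auto simp: isom_def\<close>)
qed

text \<open>On a finite support \<open>F\<close> of the formula, one tuple \<open>g\<close> looks
  from infinitely many copies as the original tuple looks from \<open>F\<close>. Undoing each
  \<open>h l\<close> makes the support bound apply, so \<phi> is at most \<epsilon> on
  \<open>k\<close> instances at once.\<close>

lemma not_type_divides:
  assumes A: "A \<subseteq> mspace M" "density_le K (mdist M) A" and B: "B \<subseteq> mspace M" "density_le K (mdist M) B"
    and C: "C \<subseteq> mspace M" "density_le K (mdist M) C"
    and compat: "compatible M A B C"
  shows "\<not> type_divides M C A (tp_set M A (B \<union> C))"
proof
  define D where "D = B \<union> C"
  have D: "D \<subseteq> mspace M" "density_le K (mdist M) D" using B C by (auto simp: D_def intro: density_le_Un)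
  assume "type_divides M C A (tp_set M A (B \<union> C))"
  then obtain \<phi> "is" b where is_b: "set is \<subseteq> A" "set b \<subseteq> mspace M"
    and \<phi>: "fm_of_arity (length is + length b) \<phi>" and div: "fm_divides M C \<phi> (length is) b"
    and all: "\<And>f. realizes M A f (tp_set M A D) \<Longrightarrow> val_at M \<phi> (map f is @ b) = 0"
    unfolding type_divides_def D_def by blast
  obtain bs :: "nat \<Rightarrow> 'a list" and \<epsilon> k where \<epsilon>: "\<epsilon> > 0" and "k > 0"
    and bs: "\<forall>l. length (bs l) = length b \<and> set (bs l) \<subseteq> mspace M \<and> tp_tuple M (bs l) C = tp_tuple M b C"
    and unsat: "\<forall>N. finite N \<and> card N = k \<longrightarrow> \<not> (\<exists>as. length as = length is \<and> set as \<subseteq> mspace M \<and>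
      (\<forall>l\<in>N. max (val_at M \<phi> (as @ bs l) - \<epsilon>) 0 = 0))"
    using div unfolding fm_divides_def by (elim exE conjE)
  obtain F where F: "F \<subseteq> D" "finite F" and supp: "\<forall>g. g ` set is \<subseteq> mspace M \<and>
      (\<forall>i\<in>set is. \<forall>j\<in>set is. mdist M (g i) (g j) = mdist M i j) \<and>
      (\<forall>i\<in>set is. \<forall>e\<in>F. mdist M (g i) e = mdist M i e) \<longrightarrow> val_at M \<phi> (map g is @ b) \<le> \<epsilon>"
    by (rule finite_support[OF A D is_b \<phi> _ \<epsilon>, THEN exE]) (erule all, elim conjE, erule (2) that)
  have FM: "F \<subseteq> mspace M" using F(1) D(1) by blast
  have "\<exists>h. isom M (mdist M) (C \<union> set b \<union> F) h \<and> (\<forall>c\<in>C. h c = c) \<and> map h b = bs l" for l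
    using extend_tp_isom[OF is_b(2) _ _ _ C F(2) FM, of "bs l"] bs by metis
  then obtain h where h: "\<And>l. isom M (mdist M) (C \<union> set b \<union> F) (h l)" "\<And>l c. c \<in> C \<Longrightarrow> h l c = c"
    "\<And>l. map (h l) b = bs l" by metis
  have hCF: "isom M (mdist M) (C \<union> F) (h l)" for l using h(1)[of l] by (auto simp: isom_def)
  obtain L g where L: "infinite L" and g: "g ` set is \<subseteq> mspace M"
    "\<And>i j. i \<in> set is \<Longrightarrow> j \<in> set is \<Longrightarrow> mdist M (g i) (g j) = mdist M i j"
    "\<And>i l x. i \<in> set is \<Longrightarrow> l \<in> L \<Longrightarrow> x \<in> F \<Longrightarrow> mdist M (g i) (h l x) = mdist M i x"
    by (rule common_realization[OF A(1) B(1) C(1) compat List.finite_set is_b(1) F(2) F(1)[unfolded D_def],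
          where h = h]) (rule hCF, erule h(2), rule that)
  have le: "val_at M \<phi> (map g is @ bs l) \<le> \<epsilon>" if l: "l \<in> L" for l
  proof -
    \<comment> \<open>The configuration of \<open>bs l\<close>, the copy of \<open>F\<close> and
      \<open>g\<close> is rebuilt as \<open>q\<close> with \<open>h l\<close> undone:
      \<open>q\<close> is the identity on \<open>b\<close> and \<open>F\<close> and has the same
      distances.\<close>
    define P where "P = case_sum (h l) g"
    define r where "r u w = mdist M (P u) (P w)" for u w :: "'a + 'a"
    define J where "J = (Inl ` (set b \<union> F) :: ('a + 'a) set)"
    define N where "N = (Inr ` set is :: ('a + 'a) set)"
    have hM: "h l x \<in> mspace M" if "x \<in> set b \<union> F" for x using h(1)[of l] that by (auto simp: isom_def)
    have hd: "mdist M (h l x) (h l y) = mdist M x y" if "x \<in> set b \<union> F" "y \<in> set b \<union> F" for x y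
      using h(1)[of l] that unfolding isom_def by blast
    have PM: "P u \<in> mspace M" if "u \<in> J \<union> N" for u
      using that hM g(1) by (auto simp: P_def J_def N_def)
    have bF: "x \<in> mspace M" if "x \<in> set b \<union> F" for x using that is_b(2) FM by blast
    have "pseudometric_on (J \<union> N) r"
      unfolding pseudometric_on_def r_def
      by (intro conjI ballI mdist_same mdist_commute mdist_le_1 mdist_triangle PM)
    moreover have "density_le K r J" "density_le K r N"
      by (intro density_le_if_card finite_le_K; use F(2) PM in \<open>auto simp: J_def N_def r_def\<close>)+
    moreover have "isom M r J projl"
      using bF hd by (auto simp: isom_def r_def J_def P_def)
    ultimately obtain q where q: "isom M r (J \<union> N) q" "\<And>u. u \<in> J \<Longrightarrow> q u = projl u"
      using extend_isom by metis
    have qd: "mdist M (q u) (q w) = mdist M (P u) (P w)" if "u \<in> J \<union> N" "w \<in> J \<union> N" for u w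
      using q(1) that unfolding isom_def r_def by blast
    have qM: "q u \<in> mspace M" if "u \<in> J \<union> N" for u using q(1) that by (auto simp: isom_def)
    have qb: "q (Inl x) = x" if "x \<in> set b \<union> F" for x using q(2)[of "Inl x"] that by (simp add: J_def)
    have "val_at M \<phi> (map (\<lambda>i. q (Inr i)) is @ b) \<le> \<epsilon>"
    proof (rule supp[rule_format], intro conjI ballI)
      show "(\<lambda>i. q (Inr i)) ` set is \<subseteq> mspace M" using qM by (auto simp: N_def)
      show "mdist M (q (Inr i)) (q (Inr j)) = mdist M i j" if "i \<in> set is" "j \<in> set is" for i j
        using qd[of "Inr i" "Inr j"] that g(2) by (simp add: N_def P_def)
      show "mdist M (q (Inr i)) e = mdist M i e" if "i \<in> set is" "e \<in> F" for i e
        using qd[of "Inr i" "Inl e"] qb[of e] that g(3)[OF that(1) l that(2)]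
        by (simp add: J_def N_def P_def)
    qed
    also have "val_at M \<phi> (map (\<lambda>i. q (Inr i)) is @ b) = val_at M \<phi> (map q (map Inr is @ map Inl b))"
      using qb by (simp add: comp_def map_idI)
    also have "\<dots> = val_at M \<phi> (map P (map Inr is @ map Inl b))"
    proof (rule val_at_map_isometric)
      have sub: "set (map Inr is @ map Inl b) \<subseteq> J \<union> N" by (auto simp: J_def N_def)
      then show "q ` set (map Inr is @ map Inl b) \<subseteq> mspace M" "P ` set (map Inr is @ map Inl b) \<subseteq> mspace M"
        using qM PM by blast+
      show "mdist M (q u) (q w) = mdist M (P u) (P w)"
        if "u \<in> set (map Inr is @ map Inl b)" "w \<in> set (map Inr is @ map Inl b)" for u w
        using qd sub that by blast
    qed (use \<phi> in simp)
    also have "map P (map Inr is @ map Inl b) = map g is @ bs l"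
      using h(3)[of l] by (simp add: P_def comp_def)
    finally show ?thesis .
  qed
  obtain N where N: "N \<subseteq> L" "finite N" "card N = k"
    using infinite_arbitrarily_large[OF L] by blast
  have "\<forall>l\<in>N. max (val_at M \<phi> (map g is @ bs l) - \<epsilon>) 0 = 0" using le N(1) by (auto simp: max_def)
  moreover have "length (map g is) = length is" "set (map g is) \<subseteq> mspace M" using g(1) by auto
  ultimately show False using unsat[rule_format, OF conjI[OF N(2,3)]] by blast
qed
end

section \<open>The characterization of dividing\<close>

lemma density_le_dense:
  assumes "dense_in M S A" "|S| \<le>o |K|"
  shows "density_le K (mdist M) A"
proof -
  have "\<exists>y\<in>S. mdist M x y < e" if "x \<in> A" "e > 0" for x e
  proof -
    have "x \<in> mtopology_of M closure_of S" using assms(1) that by (auto simp: dense_in_def)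
    then show ?thesis
      using that(2) unfolding mtopology_of_def Metric_space.metric_closure_of[OF Metric_space_mspace_mdist]
      by (auto simp: Metric_space.in_mball[OF Metric_space_mspace_mdist])
  qed
  then show ?thesis using assms by (auto simp: density_le_def dense_in_def)
qed

text \<open>Joining the naturals to \<open>W\<close> makes the bound infinite at no cost: for
  infinite \<open>W\<close> its own degree of saturation suffices, for finite \<open>W\<close> that
  of the monster model.\<close>

lemma ordLess_cardSuc_or:
  assumes "|D| \<le>o |W <+> (UNIV :: nat set)|"
  shows "|D| <o cardSuc |W| \<or> |D| <o cardSuc natLeq"
proof (cases "finite W")
  case True
  then have "|W| \<le>o |UNIV :: nat set|"
    by (intro countable_ordLeq_nat countable_finite)
  then have "|W <+> (UNIV :: nat set)| =o |UNIV :: nat set|"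
    by (intro card_of_Plus_infinite2) simp_all
  then have "|D| \<le>o natLeq"
    by (rule ordLeq_ordIso_trans[OF ordLeq_ordIso_trans[OF assms] card_of_nat])
  then show ?thesis using cardSuc_ordLeq_ordLess[OF natLeq_Card_order card_of_Card_order] by blast
next
  case False
  then have "|W <+> (UNIV :: nat set)| =o |W|"
    by (intro card_of_Plus_infinite1) (simp_all add: infinite_iff_card_of_nat)
  then have "|D| \<le>o |W|" by (rule ordLeq_ordIso_trans[OF assms])
  then show ?thesis using cardSuc_ordLeq_ordLess[OF card_of_Card_order card_of_Card_order] by blast
qed

context saturated_urysohn
begin

section \<open>The interval of admissible values\<close>

lemma le_dmax_iff:
  "x \<le> dmax M b1 b2 C \<longleftrightarrow> x \<le> 1 \<and> (\<forall>c\<in>C. x \<le> mdist M b1 c + mdist M b2 c)"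
proof -
  have "bdd_below (insert 1 ((\<lambda>c. trunc_add (mdist M b1 c) (mdist M b2 c)) ` C))"
    by (auto simp: trunc_add_def intro!: bdd_belowI[of _ 0])
  then show ?thesis unfolding dmax_def by (subst le_cInf_iff) (auto simp: trunc_add_def)
qed

lemma dmin_le_iff:
  assumes b: "b1 \<in> mspace M" "b2 \<in> mspace M" and C: "C \<subseteq> mspace M"
  shows "dmin M b1 b2 C \<le> x \<longleftrightarrow>
    mdist M b1 b2 \<le> 3 * x \<and> (\<forall>c\<in>C. \<bar>mdist M b1 c - mdist M b2 c\<bar> \<le> x)"
proof -
  have "\<bar>mdist M b1 c - mdist M b2 c\<bar> \<le> 1" if "c \<in> C" for c
    using mdist_le_1[OF b(1), of c] mdist_le_1[OF b(2), of c] that C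
      mdist_nonneg[of M b1 c] mdist_nonneg[of M b2 c] by (auto simp del: mdist_nonneg)
  then have bdd: "bdd_above (insert 0 ((\<lambda>c. \<bar>mdist M b1 c - mdist M b2 c\<bar>) ` C))"
    by (intro bdd_aboveI[of _ 1]) auto
  have "dmin M b1 b2 C \<le> x \<longleftrightarrow>
      (0 \<le> x \<and> (\<forall>c\<in>C. \<bar>mdist M b1 c - mdist M b2 c\<bar> \<le> x)) \<and> mdist M b1 b2 / 3 \<le> x"
    using cSup_le_iff[OF _ bdd, of x] unfolding dmin_def by simp
  moreover have "0 \<le> x" if "mdist M b1 b2 \<le> 3 * x" using that mdist_nonneg[of M b1 b2] by linarith
  ultimately show ?thesis by auto
qed

text \<open>Enlarging \<open>C\<close> to \<open>A \<union> C\<close> can only lower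
  \<open>dmax\<close> and raise \<open>dmin\<close>, so the equalities say that the interval between
  them does not shrink. Compatibility says this for each point of the interval.\<close>

lemma compatible_iff:
  assumes A: "A \<subseteq> mspace M" and B: "B \<subseteq> mspace M" and C: "C \<subseteq> mspace M"
  shows "compatible M A B C \<longleftrightarrow> (\<forall>b1\<in>B. \<forall>b2\<in>B.
    dmax M b1 b2 (A \<union> C) = dmax M b1 b2 C \<and> dmin M b1 b2 (A \<union> C) = dmin M b1 b2 C)"
proof -
  have AC: "A \<union> C \<subseteq> mspace M" using A C by blast
  have "(\<forall>a\<in>A. \<forall>E. E \<le> 1 \<and> mdist M b1 b2 \<le> 3 * E \<and>
        (\<forall>c\<in>C. \<bar>mdist M b1 c - mdist M b2 c\<bar> \<le> E \<and> E \<le> mdist M b1 c + mdist M b2 c) \<longrightarrow>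
        \<bar>mdist M b1 a - mdist M b2 a\<bar> \<le> E \<and> E \<le> mdist M b1 a + mdist M b2 a) \<longleftrightarrow>
      dmax M b1 b2 (A \<union> C) = dmax M b1 b2 C \<and> dmin M b1 b2 (A \<union> C) = dmin M b1 b2 C"
    (is "?L \<longleftrightarrow> ?R") if "b1 \<in> B" "b2 \<in> B" for b1 b2
  proof -
    have b: "b1 \<in> mspace M" "b2 \<in> mspace M" using that B by auto
    note min_iff = dmin_le_iff[OF b]
    have L: "?L \<longleftrightarrow> (\<forall>a\<in>A. \<forall>E. dmin M b1 b2 C \<le> E \<and> E \<le> dmax M b1 b2 C \<longrightarrow>
        \<bar>mdist M b1 a - mdist M b2 a\<bar> \<le> E \<and> E \<le> mdist M b1 a + mdist M b2 a)"
      unfolding min_iff[OF C] le_dmax_iff by blast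
    \<comment> \<open>The interval is nonempty because it contains the actual distance of
      \<open>b1\<close> and \<open>b2\<close>.\<close>
    have "mdist M b1 b2 \<le> dmax M b1 b2 C"
      unfolding le_dmax_iff using mdist_le_1[OF b] mdist_triangle[OF b(1) _ b(2)] C
      by (auto simp: mdist_commute[of M b2])
    moreover have "0 \<le> mdist M b1 b2" by simp
    moreover have "\<bar>mdist M b1 c - mdist M b2 c\<bar> \<le> mdist M b1 b2" if "c \<in> C" for c
      using mdist_triangle[OF b, of c] mdist_triangle[OF b(2,1), of c] that C
      by (auto simp: mdist_commute[of M b2 b1])
    ultimately have le: "dmin M b1 b2 C \<le> dmax M b1 b2 C"
      unfolding min_iff[OF C] by (intro conjI ballI) (linarith, rule order_trans)
    have mono: "dmax M b1 b2 (A \<union> C) \<le> dmax M b1 b2 C" "dmin M b1 b2 C \<le> dmin M b1 b2 (A \<union> C)"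
      using le_dmax_iff[of "dmax M b1 b2 (A \<union> C)" b1 b2 C]
        le_dmax_iff[of "dmax M b1 b2 (A \<union> C)" b1 b2 "A \<union> C"] min_iff[OF AC, of "dmin M b1 b2 (A \<union> C)"]
        min_iff[OF C, of "dmin M b1 b2 (A \<union> C)"] by auto
    have "?R \<longleftrightarrow> dmax M b1 b2 C \<le> dmax M b1 b2 (A \<union> C) \<and> dmin M b1 b2 (A \<union> C) \<le> dmin M b1 b2 C"
      using mono by auto
    also have "\<dots> \<longleftrightarrow> (\<forall>a\<in>A. dmax M b1 b2 C \<le> mdist M b1 a + mdist M b2 a \<and>
        \<bar>mdist M b1 a - mdist M b2 a\<bar> \<le> dmin M b1 b2 C)"
      using le_dmax_iff[of "dmax M b1 b2 C" b1 b2] min_iff[OF AC, of "dmin M b1 b2 C"]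
        min_iff[OF C, of "dmin M b1 b2 C"] by auto
    \<comment> \<open>Testing the two endpoints is enough; they are admissible since
      \<open>dmin \<le> dmax\<close>.\<close>
    also have "\<dots> \<longleftrightarrow> ?L"
      unfolding L using le by (meson order_refl order_trans)
    finally show ?thesis by blast
  qed
  then show ?thesis unfolding compatible_def by (intro ball_cong refl)
qed

lemma div_indep_iff_compatible:
  assumes A: "A \<subseteq> mspace M" "density_le K (mdist M) A" and B: "B \<subseteq> mspace M" "density_le K (mdist M) B"
    and C: "C \<subseteq> mspace M" "density_le K (mdist M) C"
  shows "div_indep M A C B \<longleftrightarrow> compatible M A B C"
proof
  assume indep: "div_indep M A C B"
  show "compatible M A B C"
    unfolding compatible_def
  proof (intro ballI allI impI, elim conjE, rule ccontr)
    fix b1 b2 a E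
    assume "b1 \<in> B" "b2 \<in> B" "a \<in> A" "E \<le> 1" "mdist M b1 b2 \<le> 3 * E"
      "\<forall>c\<in>C. \<bar>mdist M b1 c - mdist M b2 c\<bar> \<le> E \<and> E \<le> mdist M b1 c + mdist M b2 c"
      "\<not> (\<bar>mdist M b1 a - mdist M b2 a\<bar> \<le> E \<and> E \<le> mdist M b1 a + mdist M b2 a)"
    then have "type_divides M C A (tp_set M A (B \<union> C))"
      using A(1) B(1) C by (intro type_divides_if_separated[of A a _ b1 b2 C E]) auto
    then show False using indep by (simp add: div_indep_def)
  qed
next
  assume "compatible M A B C"
  then show "div_indep M A C B" unfolding div_indep_def by (rule not_type_divides[OF A B C])
qed

end

theorem theorem3p19:
  fixes U :: "'u metric" and M :: "'a metric" and A B C :: "'a set"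
  assumes "urysohn_sphere U"
    and "monster_model M (Th U)"
    and "A \<subseteq> mspace M" and "B \<subseteq> mspace M" and "C \<subseteq> mspace M"
    and "small M A" and "small M B" and "small M C"
  shows "div_indep M A C B \<longleftrightarrow>
    (\<forall>b1\<in>B. \<forall>b2\<in>B. dmax M b1 b2 (A \<union> C) = dmax M b1 b2 C \<and>
                    dmin M b1 b2 (A \<union> C) = dmin M b1 b2 C)"
proof -
  obtain SA SB SC where S: "dense_in M SA A" "dense_in M SB B" "dense_in M SC C"
    and sat: "saturated M (cardSuc |SA| )" "saturated M (cardSuc |SB| )" "saturated M (cardSuc |SC| )"
    using assms(6-8) unfolding small_def by (elim exE conjE)
  \<comment> \<open>The largest of the three dense sets provides a single degree of saturation for
    \<open>A\<close>, \<open>B\<close> and \<open>C\<close>.\<close>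
  have "\<exists>W\<in>{SA, SB, SC}. |SA| \<le>o |W| \<and> |SB| \<le>o |W| \<and> |SC| \<le>o |W|"
    using ordLeq_total[OF card_of_Well_order card_of_Well_order, of SA SB]
      ordLeq_total[OF card_of_Well_order card_of_Well_order, of SA SC]
      ordLeq_total[OF card_of_Well_order card_of_Well_order, of SB SC]
      card_of_refl ordIso_imp_ordLeq ordLeq_transitive by (metis insertCI)
  then obtain W where W_in: "W \<in> {SA, SB, SC}" and SW: "|SA| \<le>o |W| \<and> |SB| \<le>o |W| \<and> |SC| \<le>o |W|"
    by (elim bexE)
  have W: "saturated M (cardSuc |W| )" using W_in sat by auto
  define K where "K = W <+> (UNIV :: nat set)"
  have SK: "|SA| \<le>o |K|" "|SB| \<le>o |K|" "|SC| \<le>o |K|"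
    unfolding K_def using SW ordLeq_transitive[OF _ card_of_Plus1] by blast+
  have M: "model_of M (Th U)" "saturated M (cardSuc natLeq)"
    using assms(2) by (auto simp: monster_model_def)
  interpret saturated_urysohn M K
  proof
    show "metric_structure M" using M(1) by (simp add: model_of_def)
    show "infinite K" by (simp add: K_def)
    show "\<exists>y\<in>mspace M. (\<Sum>i<n. \<bar>mdist M (x i) y - r i\<bar>) < e"
      if "\<And>i. i < n \<Longrightarrow> x i \<in> mspace M" "\<And>i. i < n \<Longrightarrow> r i \<le> 1"
        "\<And>i j. i < n \<Longrightarrow> j < n \<Longrightarrow>
          \<bar>r i - r j\<bar> \<le> mdist M (x i) (x j) \<and> mdist M (x i) (x j) \<le> r i + r j" "e > 0"
      for n :: nat and x r e
      using model_ext_approx[OF assms(1) M(1), of n x r e] that by blast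
    show "satisfiable M {..<n} \<Gamma>"
      if "D \<subseteq> mspace M" "|D| \<le>o |K|" "\<Gamma> \<subseteq> conditions {..<n} D"
        "\<And>\<Delta>. \<Delta> \<subseteq> \<Gamma> \<Longrightarrow> finite \<Delta> \<Longrightarrow> satisfiable M {..<n} \<Delta>"
      for D n and \<Gamma> :: "(nat, 'a) condition set"
      using ordLess_cardSuc_or[of D W] that W M(2) unfolding K_def saturated_def by blast
  qed
  have "density_le K (mdist M) A" "density_le K (mdist M) B" "density_le K (mdist M) C"
    using density_le_dense S SK by blast+
  then show ?thesis
    using div_indep_iff_compatible compatible_iff assms(3-5) by simp
qed

end
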